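(* Let $M$ be a simple 2-connected planar map such that both $M$ and its dual $M^*$ are weakly outerplanar. Then $\dim(\mathbf{P}_{VF}(M)) \le 3$.
   Context: A planar map $M=(G,D)$ consists of a finite planar multigraph $G$ with a plane drawing $D$, determining vertices, edges, faces and incidences. The vertex-face poset $\mathbf{P}_{VF}(M)$ is the poset on vertices and faces of $M$, with a vertex below a face if it lies on the boundary of that face. The dimension of a poset is the minimum number of linear orders whose intersection is the order. The dual map $M^*$ has a vertex $F^*$ for each face $F$ of $M$ and an edge $e^*$ for each edge $e$ of $M$ joining the dual vertices of the faces separated by $e$. A map is weakly outerplanar if its underlying graph is outerplanar. *)

theory Defs
  imports "HOL-Analysis.Analysis" "HOL-Library.Extended_Nat"
begin

section \<open>Multigraphs\<close>

text \<open>An edge is a loop iff its set of ends is a singleton.\<close>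

record ('v, 'e) multigraph =
  verts :: "'v set"
  edges :: "'e set"
  ends :: "'e \<Rightarrow> 'v set"

definition finite_multigraph :: "('v, 'e) multigraph \<Rightarrow> bool" where
  "finite_multigraph G \<longleftrightarrow> finite (verts G) \<and> finite (edges G) \<and>
     (\<forall>e\<in>edges G. ends G e \<subseteq> verts G \<and> card (ends G e) \<in> {1, 2})"

definition simple_graph :: "('v, 'e) multigraph \<Rightarrow> bool" where
  "simple_graph G \<longleftrightarrow> (\<forall>e\<in>edges G. card (ends G e) = 2) \<and> inj_on (ends G) (edges G)"

definition adjacency :: "('v, 'e) multigraph \<Rightarrow> ('v \<times> 'v) set" where
  "adjacency G = {(u, v). \<exists>e\<in>edges G. ends G e = {u, v}}"

definition connected_graph :: "('v, 'e) multigraph \<Rightarrow> bool" where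
  "connected_graph G \<longleftrightarrow> verts G \<noteq> {} \<and> (\<forall>u\<in>verts G. \<forall>v\<in>verts G. (u, v) \<in> (adjacency G)\<^sup>*)"

definition delete_verts :: "('v, 'e) multigraph \<Rightarrow> 'v set \<Rightarrow> ('v, 'e) multigraph" where
  "delete_verts G X =
     \<lparr>verts = verts G - X, edges = {e \<in> edges G. ends G e \<inter> X = {}}, ends = ends G\<rparr>"

definition k_connected :: "nat \<Rightarrow> ('v, 'e) multigraph \<Rightarrow> bool" where
  "k_connected k G \<longleftrightarrow> card (verts G) > k \<and>
     (\<forall>X. X \<subseteq> verts G \<and> card X < k \<longrightarrow> connected_graph (delete_verts G X))"

section \<open>Plane drawings\<close>

record ('v, 'e) drawing =
  point :: "'v \<Rightarrow> complex"
  curve :: "'e \<Rightarrow> real \<Rightarrow> complex"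

text \<open>
  A \<^const>\<open>simple_path\<close> may be closed, but only by identifying its two endpoints. So the conditions
  below make a non-loop a Jordan arc and a loop a Jordan curve through its vertex. Two distinct
  edges may meet only in vertex points, and by the preceding condition such a point is a common end.
\<close>

definition plane_drawing :: "('v, 'e) multigraph \<Rightarrow> ('v, 'e) drawing \<Rightarrow> bool" where
  "plane_drawing G D \<longleftrightarrow>
     inj_on (point D) (verts G) \<and>
     (\<forall>e\<in>edges G. simple_path (curve D e) \<and>
        {pathstart (curve D e), pathfinish (curve D e)} = point D ` ends G e \<and>
        path_image (curve D e) \<inter> point D ` verts G = point D ` ends G e) \<and>
     (\<forall>e\<in>edges G. \<forall>f\<in>edges G. e \<noteq> f \<longrightarrow>
        path_image (curve D e) \<inter> path_image (curve D f) \<subseteq> point D ` verts G)"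

definition skeleton :: "('v, 'e) multigraph \<Rightarrow> ('v, 'e) drawing \<Rightarrow> complex set" where
  "skeleton G D = point D ` verts G \<union> (\<Union>e\<in>edges G. path_image (curve D e))"

definition drawing_faces :: "('v, 'e) multigraph \<Rightarrow> ('v, 'e) drawing \<Rightarrow> complex set set" where
  "drawing_faces G D = components (- skeleton G D)"

definition outerplanar :: "('v, 'e) multigraph \<Rightarrow> bool" where
  "outerplanar G \<longleftrightarrow> finite_multigraph G \<and>
     (\<exists>D. plane_drawing G D \<and>
        (\<exists>F\<in>drawing_faces G D. \<not> bounded F \<and> (\<forall>v\<in>verts G. point D v \<in> frontier F)))"

section \<open>Planar maps\<close>

type_synonym ('v, 'e) map = "('v, 'e) multigraph \<times> ('v, 'e) drawing"

definition planar_map :: "('v, 'e) map \<Rightarrow> bool" where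
  "planar_map M \<longleftrightarrow> finite_multigraph (fst M) \<and> plane_drawing (fst M) (snd M)"

definition simple_map :: "('v, 'e) map \<Rightarrow> bool" where
  "simple_map M \<longleftrightarrow> simple_graph (fst M)"

definition two_connected_map :: "('v, 'e) map \<Rightarrow> bool" where
  "two_connected_map M \<longleftrightarrow> k_connected 2 (fst M)"

definition weakly_outerplanar :: "('v, 'e) map \<Rightarrow> bool" where
  "weakly_outerplanar M \<longleftrightarrow> outerplanar (fst M)"

definition faces :: "('v, 'e) map \<Rightarrow> complex set set" where
  "faces M = drawing_faces (fst M) (snd M)"

text \<open>
  The underlying multigraph of the dual map: the dual vertex of a face is the face itself, and the
  dual edge of \<open>e\<close> is \<open>e\<close> itself, joining the faces that have \<open>e\<close> on their boundary. There are one
  or two such faces; if there is only one (that is, if \<open>e\<close> is a bridge), the dual edge is a loop.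
  Weak outerplanarity of the dual map depends on this multigraph only, and not on how the dual is
  drawn.
\<close>

definition dual_graph :: "('v, 'e) map \<Rightarrow> (complex set, 'e) multigraph" where
  "dual_graph M =
     \<lparr>verts = faces M,
      edges = edges (fst M),
      ends = (\<lambda>e. {F \<in> faces M. path_image (curve (snd M) e) \<subseteq> frontier F})\<rparr>"

section \<open>The vertex-face poset and order dimension\<close>

definition VF_carrier :: "('v, 'e) map \<Rightarrow> ('v + complex set) set" where
  "VF_carrier M = verts (fst M) <+> faces M"

definition VF_order :: "('v, 'e) map \<Rightarrow> ('v + complex set) rel" where
  "VF_order M = Id_on (VF_carrier M) \<union>
     {(Inl v, Inr F) | v F. v \<in> verts (fst M) \<and> F \<in> faces M \<and> point (snd M) v \<in> frontier F}"

lemma partial_order_on_VF_order: "partial_order_on (VF_carrier M) (VF_order M)"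
  unfolding partial_order_on_def preorder_on_def refl_on_def trans_def antisym_def
    VF_order_def VF_carrier_def
  by auto

definition realizer :: "'a set \<Rightarrow> 'a rel \<Rightarrow> 'a rel set \<Rightarrow> bool" where
  "realizer A r S \<longleftrightarrow> S \<noteq> {} \<and> (\<forall>L\<in>S. linear_order_on A L) \<and> \<Inter>S = r"

text \<open>The value is infinite if there is no finite realizer.\<close>

definition order_dim :: "'a set \<Rightarrow> 'a rel \<Rightarrow> enat" where
  "order_dim A r = (INF S\<in>{S. finite S \<and> realizer A r S}. enat (card S))"

end

theory Submission
  imports Defs
begin

text \<open>
  A 2-connected outerplanar graph has a Hamiltonian cycle, since it has no \<open>K\<^sub>2\<^sub>,\<^sub>3\<close> minor, and no two
  of its chords cross. If three chords cut off internally disjoint arcs of the cycle, then the dual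
  has a \<open>K\<^sub>2\<^sub>,\<^sub>3\<close> minor, whichever side of the cycle each chord is drawn on. Hence the two arcs cut off by
  each chord can be labelled left and right such that the left arcs form a chain under inclusion, and
  so do the right arcs. A vertex lies on a face unless some chord separates the two, so the vertex set
  of a face is an intersection of such arcs, hence of one member of each chain. Listing the vertices
  along each chain and inserting every face directly after its vertices gives two linear extensions
  that reverse all incomparable vertex-face pairs, and a third one takes care of the pairs of vertices
  and the pairs of faces.
\<close>

section \<open>Arcs and theta curves\<close>

text \<open>Weak outerplanarity concerns the abstract graph, so two drawings of it are in play:
  \<open>D\<close>, whose faces enter the poset, and a drawing \<open>D'\<close> with all vertices
  on one face. The Hamiltonian cycle and the absence of crossing chords are read off
  \<open>D'\<close> and then hold for the graph. In \<open>D\<close> a chord may run on either side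
  of the cycle, so the cyclic order alone does not determine the faces. Both exclusions of K23 rest
  on one fact of plane topology: no connected set off a theta curve accumulates at interior points
  of all three arcs. Faces are never traced along boundary walks. Whether a vertex lies on a face is
  a question of separation, which Janiszewski's theorem reduces from the whole drawing to single
  closed curves. The two chains come from a chord of shortest span. By non-crossing and minimality
  every chord has both ends on the long arc of this one, and two chords with disjoint arcs there
  would, together with the shortest one, be three chords that cut off disjoint arcs. So the arcs
  within the long arc are nested.\<close>

definition arc_set :: "complex set \<Rightarrow> complex \<Rightarrow> complex \<Rightarrow> bool" where
  "arc_set K a b \<longleftrightarrow> (\<exists>g. arc g \<and> pathstart g = a \<and> pathfinish g = b \<and> path_image g = K)"

lemma arc_set_sym: "arc_set K a b \<Longrightarrow> arc_set K b a"
  unfolding arc_set_def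
  by (metis arc_reversepath path_image_reversepath pathfinish_reversepath pathstart_reversepath)

lemma arc_set_ends: "arc_set K a b \<Longrightarrow> a \<in> K \<and> b \<in> K \<and> a \<noteq> b"
  unfolding arc_set_def
  by (metis arc_distinct_ends pathfinish_in_path_image pathstart_in_path_image)

lemma arc_set_compact: "arc_set K a b \<Longrightarrow> compact K"
  unfolding arc_set_def by (metis compact_arc_image)

lemma arc_set_connected: "arc_set K a b \<Longrightarrow> connected K"
  unfolding arc_set_def by (metis connected_arc_image)

lemma arc_set_path_connected: "arc_set K a b \<Longrightarrow> path_connected K"
  unfolding arc_set_def by (metis arc_imp_path path_connected_path_image)

lemma arc_set_connected_Compl: "arc_set K a b \<Longrightarrow> connected (- K)"
  unfolding arc_set_def by (metis connected_arc_complement DIM_complex order_refl)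

lemma arc_set_join:
  assumes "arc_set K a b" "arc_set L b c" "K \<inter> L = {b}"
  shows "arc_set (K \<union> L) a c"
proof -
  obtain g h where "arc g" "pathstart g = a" "pathfinish g = b" "path_image g = K"
    "arc h" "pathstart h = b" "pathfinish h = c" "path_image h = L"
    using assms unfolding arc_set_def by blast
  then show ?thesis
    unfolding arc_set_def using assms(3)
    by (intro exI[of _ "g +++ h"]) (auto intro!: arc_join simp: path_image_join)
qed

lemma arc_image_interior:
  assumes "arc g" "pathstart g = a" "pathfinish g = b"
  shows "path_image g - {a, b} = g ` {0<..<1}" "path_image g - {a} = g ` {0<..1}"
proof -
  have inj: "inj_on g {0..1}" and ab: "a = g 0" "b = g 1"
    using assms by (auto simp: arc_def pathstart_def pathfinish_def)
  have "g ` ({0..1} - {0, 1}) = g ` {0..1} - g ` {0, 1}"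
    by (rule inj_on_image_set_diff[OF inj]) auto
  moreover have "{0..1} - {0, 1::real} = {0<..<1}" by auto
  ultimately show "path_image g - {a, b} = g ` {0<..<1}"
    by (simp add: path_image_def ab)
  have "g ` ({0..1} - {0}) = g ` {0..1} - g ` {0}"
    by (rule inj_on_image_set_diff[OF inj]) auto
  moreover have "{0..1} - {0::real} = {0<..1}" by auto
  ultimately show "path_image g - {a} = g ` {0<..1}"
    by (simp add: path_image_def ab)
qed

lemma arc_continuous_on: "arc g \<Longrightarrow> S \<subseteq> {0..1} \<Longrightarrow> continuous_on S g"
  by (meson arc_imp_path continuous_on_subset path_def)

lemma arc_set_path_connected_delete:
  assumes "arc_set K a b" shows "path_connected (K - {a})"
proof -
  obtain g where g: "arc g" "pathstart g = a" "pathfinish g = b" "path_image g = K"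
    using assms arc_set_def by auto
  have "path_connected (g ` {0<..1})"
    by (intro path_connected_continuous_image arc_continuous_on[OF g(1)] convex_imp_path_connected) auto
  then show ?thesis
    using arc_image_interior(2)[OF g(1-3)] g(4) by simp
qed

lemma arc_set_interior:
  assumes "arc_set K a b"
  shows "connected (K - {a, b})" "K - {a, b} \<noteq> {}" "K \<subseteq> closure (K - {a, b})"
proof -
  obtain g where g: "arc g" "pathstart g = a" "pathfinish g = b" "path_image g = K"
    using assms arc_set_def by auto
  have K: "K - {a, b} = g ` {0<..<1}" using arc_image_interior(1)[OF g(1-3)] g(4) by simp
  have c: "continuous_on {0..1} g" using arc_continuous_on[OF g(1)] by simp
  show "connected (K - {a, b})"
    unfolding K by (intro connected_continuous_image continuous_on_subset[OF c]) auto
  show "K - {a, b} \<noteq> {}" unfolding K by simp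
  have "g ` closure {0<..<1} \<subseteq> closure (g ` {0<..<1})"
    using c by (intro image_closure_subset) (auto intro: closure_subset[THEN subsetD])
  then show "K \<subseteq> closure (K - {a, b})"
    unfolding K using g(4) by (simp add: path_image_def)
qed

text \<open>Otherwise the inverse of the parametrization would embed a nonempty open set of the
  plane into the line, against invariance of dimension.\<close>

lemma arc_set_empty_interior:
  assumes "arc_set K a b" shows "interior K = {}"
proof (rule ccontr)
  assume ne: "interior K \<noteq> {}"
  obtain g where g: "arc g" "path_image g = K"
    using assms arc_set_def by auto
  then obtain h where h: "homeomorphism {0..1} K g h"
    by (metis arc_def homeomorphism_compact path_def path_image_def compact_Icc)
  have "continuous_on (interior K) h" "inj_on h (interior K)"
    using h interior_subset unfolding homeomorphism_def
    by (meson continuous_on_subset, metis inj_on_def subsetD)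
  then have "DIM(complex) \<le> DIM(real)"
    using invariance_of_dimension[of "interior K" h] ne by auto
  then show False by simp
qed

lemma two_arcs_Jordan:
  assumes "arc_set K a b" "arc_set L a b" "K \<inter> L = {a, b}"
    and T: "connected T" "T \<inter> (K \<union> L) = {}" "T \<noteq> {}"
  obtains U N where "open U" "open N" "connected U" "connected N" "N \<noteq> {}" "T \<subseteq> U"
    "U \<inter> N = {}" "U \<union> N = - (K \<union> L)" "frontier U = K \<union> L" "frontier N = K \<union> L"
proof -
  obtain g h where gh: "arc g" "pathstart g = a" "pathfinish g = b" "path_image g = K"
    "arc h" "pathstart h = a" "pathfinish h = b" "path_image h = L"
    using assms unfolding arc_set_def by blast
  let ?c = "g +++ reversepath h"
  have "simple_path ?c"
    using gh assms(3) by (intro simple_path_join_loop) (auto simp: arc_reversepath)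
  moreover have "pathfinish ?c = pathstart ?c" using gh by simp
  moreover have im: "path_image ?c = K \<union> L" using gh by (simp add: path_image_join)
  ultimately obtain A B where AB: "A \<noteq> {}" "open A" "connected A" "B \<noteq> {}" "open B" "connected B"
     "A \<inter> B = {}" "A \<union> B = - (K \<union> L)" "frontier A = K \<union> L" "frontier B = K \<union> L"
    using Jordan_curve[of ?c] by metis
  have "T \<subseteq> A \<union> B" using AB T by blast
  then have "T \<subseteq> A \<or> T \<subseteq> B"
    using connectedD[OF T(1) AB(2,5)] AB(7) by blast
  then show ?thesis
    using that[of A B] that[of B A] AB by (metis inf_commute sup_commute)
qed

lemma connected_subset_side:
  assumes "open U" "open N" "U \<inter> N = {}" "connected T" "T \<subseteq> U \<union> N" "T \<inter> U \<noteq> {}"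
  shows "T \<subseteq> U"
  using connectedD[OF assms(4,1,2)] assms by blast

lemma connected_Un_closure_point:
  assumes "connected W" "connected K" "p \<in> closure W" "p \<in> K"
  shows "connected (W \<union> K)"
proof -
  have "connected (insert p W)"
    using assms by (intro connected_intermediate_closure[OF assms(1)]) (auto simp: closure_subset subsetD)
  then have "connected (insert p W \<union> K)"
    using assms by (intro connected_Un) auto
  then show ?thesis using assms(4) by (simp add: insert_absorb)
qed

text \<open>
  A component touching all three arcs would lie, for each pair of arcs, on the same side as the third
  arc; the other side of one pair then joins it by Janiszewski's theorem.
\<close>

lemma theta_component:
  assumes K: "arc_set K1 a b" "arc_set K2 a b" "arc_set K3 a b"
    and I: "K1 \<inter> K2 = {a, b}" "K1 \<inter> K3 = {a, b}" "K2 \<inter> K3 = {a, b}"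
    and W: "connected W" "W \<inter> (K1 \<union> K2 \<union> K3) = {}"
    and cl: "closure W \<inter> (K1 - {a, b}) \<noteq> {}" "closure W \<inter> (K2 - {a, b}) \<noteq> {}"
      "closure W \<inter> (K3 - {a, b}) \<noteq> {}"
  shows False
proof -
  have con: "connected (W \<union> (K - {a, b}))" if "arc_set K a b" "closure W \<inter> (K - {a, b}) \<noteq> {}" for K
    using that connected_Un_closure_point[OF W(1) arc_set_interior(1)[OF that(1)]] by blast
  obtain w where w: "w \<in> W" using cl by fastforce
  have d3: "(W \<union> (K3 - {a, b})) \<inter> (K1 \<union> K2) = {}" "W \<union> (K3 - {a, b}) \<noteq> {}"
  proof -
    show "(W \<union> (K3 - {a, b})) \<inter> (K1 \<union> K2) = {}"
      using W(2) equalityD1[OF I(2)] equalityD1[OF I(3)] by blast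
    show "W \<union> (K3 - {a, b}) \<noteq> {}" using w by blast
  qed
  obtain U3 N3 where 3: "open U3" "open N3" "connected U3" "connected N3" "N3 \<noteq> {}"
    "W \<union> (K3 - {a, b}) \<subseteq> U3" "U3 \<inter> N3 = {}" "U3 \<union> N3 = - (K1 \<union> K2)"
    "frontier U3 = K1 \<union> K2" "frontier N3 = K1 \<union> K2"
    by (rule two_arcs_Jordan[OF K(1,2) I(1) con[OF K(3) cl(3)] d3])
  have d2: "(W \<union> (K2 - {a, b})) \<inter> (K1 \<union> K3) = {}" "W \<union> (K2 - {a, b}) \<noteq> {}"
  proof -
    show "(W \<union> (K2 - {a, b})) \<inter> (K1 \<union> K3) = {}"
      using W(2) equalityD1[OF I(1)] equalityD1[OF I(3)] by blast
    show "W \<union> (K2 - {a, b}) \<noteq> {}" using w by blast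
  qed
  obtain U2 N2 where 2: "open U2" "open N2" "connected U2" "connected N2" "N2 \<noteq> {}"
    "W \<union> (K2 - {a, b}) \<subseteq> U2" "U2 \<inter> N2 = {}" "U2 \<union> N2 = - (K1 \<union> K3)"
    "frontier U2 = K1 \<union> K3" "frontier N2 = K1 \<union> K3"
    by (rule two_arcs_Jordan[OF K(1,3) I(2) con[OF K(2) cl(2)] d2])
  have d1: "(W \<union> (K1 - {a, b})) \<inter> (K2 \<union> K3) = {}" "W \<union> (K1 - {a, b}) \<noteq> {}"
  proof -
    show "(W \<union> (K1 - {a, b})) \<inter> (K2 \<union> K3) = {}"
      using W(2) equalityD1[OF I(1)] equalityD1[OF I(2)] by blast
    show "W \<union> (K1 - {a, b}) \<noteq> {}" using w by blast
  qed
  obtain U1 N1 where 1: "open U1" "open N1" "connected U1" "connected N1" "N1 \<noteq> {}"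
    "W \<union> (K1 - {a, b}) \<subseteq> U1" "U1 \<inter> N1 = {}" "U1 \<union> N1 = - (K2 \<union> K3)"
    "frontier U1 = K2 \<union> K3" "frontier N1 = K2 \<union> K3"
    by (rule two_arcs_Jordan[OF K(2,3) I(3) con[OF K(1) cl(1)] d1])
  have N3: "N3 \<inter> (K1 \<union> K2 \<union> K3) = {}" using 3(6-8) I by blast
  have clN3: "K1 \<union> K2 \<subseteq> closure N3" using 3(10) by (auto simp: frontier_def)
  have meet: "N3 \<inter> U \<noteq> {}" if "open U" "K - {a, b} \<subseteq> U" "K - {a, b} \<noteq> {}" "K \<subseteq> K1 \<union> K2" for U K
    using that clN3 open_Int_closure_eq_empty[of U N3] by blast
  \<comment> \<open>\<open>N3\<close> accumulates at all of \<open>K2\<close>, whose interior lies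
    in the open set \<open>U2\<close>. So \<open>N3\<close> meets \<open>U2\<close>, and being
    connected and disjoint from the three arcs it cannot leave it. The same argument with
    \<open>K1\<close> places it in \<open>U1\<close>.\<close>
  have "N3 \<subseteq> U2"
    using connected_subset_side[OF 2(1,2,7) 3(4)] N3 2(6,8) meet[OF 2(1), of K2] arc_set_interior(2)[OF K(2)]
    by blast
  moreover have "N3 \<subseteq> U1"
    using connected_subset_side[OF 1(1,2,7) 3(4)] N3 1(6,8) meet[OF 1(1), of K1] arc_set_interior(2)[OF K(1)]
    by blast
  moreover obtain n where n: "n \<in> N3" using 3(5) by blast
  ultimately have "connected_component (- (K1 \<union> K3)) n w" "connected_component (- (K2 \<union> K3)) n w"
    unfolding connected_component_def using 1(3,6,8) 2(3,6,8) w by blast+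
  \<comment> \<open>Janiszewski's theorem needs the two closed sets to have a connected
    intersection; here it is the single arc \<open>K3\<close>.\<close>
  moreover have "(K1 \<union> K3) \<inter> (K2 \<union> K3) = K3" using I arc_set_ends[OF K(3)] by blast
  ultimately have "connected_component (- ((K1 \<union> K3) \<union> (K2 \<union> K3))) n w"
    using K Janiszewski[of "K1 \<union> K3" "K2 \<union> K3"]
    by (simp add: arc_set_compact compact_Un compact_imp_closed arc_set_connected del: Compl_Un)
  then have "connected_component (- (K1 \<union> K2)) n w"
    by (rule connected_component_of_subset) blast
  then obtain T where T: "connected T" "T \<subseteq> - (K1 \<union> K2)" "n \<in> T" "w \<in> T"
    unfolding connected_component_def by blast
  show False
    using connected_subset_side[OF 3(1,2,7) T(1)] T 3(6,7,8) w n by blast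
qed

text \<open>A connected set that starts in \<open>F\<close> and misses its frontier cannot leave
  \<open>F\<close>. Below, \<open>T\<close> is a part of the drawing that still contains the
  frontier, and \<open>y\<close> a point of the removed part; putting \<open>y\<close> into
  \<open>F\<close> is then absurd.\<close>

lemma connected_component_in_frontier:
  assumes "connected_component (- T) x y" "x \<in> F" "frontier F \<subseteq> T"
  shows "y \<in> F"
proof -
  obtain C where C: "connected C" "C \<subseteq> - T" "x \<in> C" "y \<in> C"
    using assms(1) unfolding connected_component_def by blast
  show ?thesis
    using connected_Int_frontier[OF C(1), of F] C assms by blast
qed

text \<open>The sets \<open>T i\<close> are added one at a time. As the order of the induction is
  arbitrary, the intersection with \<open>T i\<close> has to be connected for every family
  \<open>J\<close> that may have been added before.\<close>

lemma Janiszewski_family: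
  fixes x y :: complex
  assumes "finite I" "compact S" "\<And>i. i \<in> I \<Longrightarrow> compact (T i)"
    and "\<And>i J. i \<in> I \<Longrightarrow> J \<subseteq> I - {i} \<Longrightarrow> connected ((S \<union> \<Union>(T ` J)) \<inter> T i)"
    and "connected_component (- S) x y" "\<And>i. i \<in> I \<Longrightarrow> connected_component (- T i) x y"
  shows "connected_component (- (S \<union> \<Union>(T ` I))) x y"
  using assms
proof (induction I)
  case (insert i I)
  have IH: "connected_component (- (S \<union> \<Union>(T ` I))) x y"
  proof (rule insert.IH)
    fix j J assume "j \<in> I" "J \<subseteq> I - {j}"
    then show "connected ((S \<union> \<Union>(T ` J)) \<inter> T j)"
      using insert.prems(3)[of j J] by blast
  qed (use insert.prems in auto)
  have "connected_component (- ((S \<union> \<Union>(T ` I)) \<union> T i)) x y"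
  proof (rule Janiszewski)
    show "compact (S \<union> \<Union>(T ` I))" using insert by (auto intro!: compact_Un compact_UN)
    show "closed (T i)" using insert.prems by (auto intro: compact_imp_closed)
    show "connected ((S \<union> \<Union>(T ` I)) \<inter> T i)" using insert.prems(3)[of i I] insert.hyps by auto
  qed (use IH insert.prems in auto)
  moreover have "S \<union> \<Union>(T ` I) \<union> T i = S \<union> \<Union>(T ` insert i I)" by auto
  ultimately show ?case by simp
qed auto

text \<open>The centre \<open>c\<close> is the point where an arc \<open>h\<close> from
  \<open>l3\<close> first hits an arc \<open>g\<close> from \<open>l1\<close> to \<open>l2\<close>.
  The two connectivity assumptions let \<open>g\<close> avoid \<open>l3\<close> and \<open>h\<close>
  avoid \<open>l1\<close> and \<open>l2\<close>, so \<open>c\<close> differs from all three and no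
  leg is degenerate.\<close>

lemma tripod:
  assumes "path_connected (X - {l3})" "path_connected (X - {l1, l2})"
    and "l1 \<in> X" "l2 \<in> X" "l3 \<in> X" "l1 \<noteq> l2" "l1 \<noteq> l3" "l2 \<noteq> l3"
  obtains c K1 K2 K3 where "arc_set K1 l1 c" "arc_set K2 l2 c" "arc_set K3 l3 c"
    "K1 \<union> K2 \<union> K3 \<subseteq> X" "K1 \<inter> K2 = {c}" "K1 \<inter> K3 = {c}" "K2 \<inter> K3 = {c}"
proof -
  obtain g where g: "arc g" "path_image g \<subseteq> X - {l3}" "pathstart g = l1" "pathfinish g = l2"
    using assms(1)[unfolded path_connected_arcwise] assms(3-8)
    by (metis Diff_iff singletonD)
  have gc: "continuous_on {0..1} g" and ginj: "inj_on g {0..1}" and g01: "g 0 = l1" "g 1 = l2"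
    using g by (auto simp: arc_def path_def pathstart_def pathfinish_def)
  \<comment> \<open>Any point of \<open>g\<close> other than its two ends would do as the target of
    \<open>h\<close>.\<close>
  define m where "m = g (1/2)"
  have m: "m \<in> path_image g" by (auto simp: m_def path_image_def)
  have "m \<noteq> l1" "m \<noteq> l2"
    using ginj unfolding m_def g01[symmetric] by (auto dest!: inj_onD)
  moreover have "m \<noteq> l3" using g m by blast
  ultimately obtain h where h: "arc h" "path_image h \<subseteq> X - {l1, l2}" "pathstart h = l3" "pathfinish h = m"
    using assms(2)[unfolded path_connected_arcwise, rule_format, of l3 m] g(2) m assms(3-8) by blast
  have hc: "continuous_on {0..1} h" and h01: "h 0 = l3" "h 1 = m" and hinj: "inj_on h {0..1}"
    using h by (auto simp: arc_def path_def pathstart_def pathfinish_def)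
  let ?T = "{0..1} \<inter> h -` path_image g"
  have "compact ?T"
    using continuous_closed_preimage[OF hc, of "path_image g"] g(1)
    by (auto simp: compact_eq_bounded_closed closed_arc_image bounded_Int)
  moreover have "1 \<in> ?T" using h01 m by simp
  ultimately obtain u where u: "u \<in> ?T" and umin: "\<And>t. t \<in> ?T \<Longrightarrow> u \<le> t"
    by (metis compact_attains_inf empty_iff)
  have u0: "u \<noteq> 0" using u h01 g(2) by auto
  obtain s where s: "s \<in> {0..1}" "g s = h u" using u by (auto simp: path_image_def)
  have "h u \<in> path_image h" using u by (simp add: path_image_def)
  then have "h u \<notin> {l1, l2}" using h(2) by blast
  then have s01: "s \<noteq> 0" "s \<noteq> 1" using s g01 by auto
  define K1 K2 K3 where "K1 = path_image (subpath 0 s g)" and "K2 = path_image (subpath 1 s g)"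
    and "K3 = path_image (subpath 0 u h)"
  have K: "K1 = g ` {0..s}" "K2 = g ` {s..1}" "K3 = h ` {0..u}"
    using s u unfolding K1_def K2_def K3_def path_image_subpath_gen
    by (auto simp: closed_segment_eq_real_ivl)
  show ?thesis
  proof
    show "arc_set K1 l1 (h u)" unfolding arc_set_def K1_def
      using g(1) s s01 g01 by (intro exI[of _ "subpath 0 s g"]) (auto intro: arc_subpath_arc)
    show "arc_set K2 l2 (h u)" unfolding arc_set_def K2_def
      using g(1) s s01 g01 by (intro exI[of _ "subpath 1 s g"]) (auto intro: arc_subpath_arc)
    show "arc_set K3 l3 (h u)" unfolding arc_set_def K3_def
      using h(1) u u0 h01 by (intro exI[of _ "subpath 0 u h"]) (auto intro: arc_subpath_arc)
    show "K1 \<union> K2 \<union> K3 \<subseteq> X"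
    proof -
      have "K1 \<union> K2 \<subseteq> path_image g" "K3 \<subseteq> path_image h"
        unfolding K path_image_def using s u by auto
      then show ?thesis using g(2) h(2) by blast
    qed
    show "K1 \<inter> K2 = {h u}"
    proof -
      have "g ` ({0..s} \<inter> {s..1}) = g ` {0..s} \<inter> g ` {s..1}"
        using s by (intro inj_on_image_Int[OF ginj]) auto
      moreover have "{0..s} \<inter> {s..1} = {s}" using s by auto
      ultimately show ?thesis using s K by simp
    qed
    have "K3 \<inter> path_image g \<subseteq> {h u}"
    proof
      fix x assume "x \<in> K3 \<inter> path_image g"
      then obtain t where "t \<in> {0..u}" "x = h t" "h t \<in> path_image g" unfolding K by auto
      then show "x \<in> {h u}" using umin[of t] u by force
    qed
    moreover have "K1 \<subseteq> path_image g" "K2 \<subseteq> path_image g" unfolding K path_image_def using s by auto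
    moreover have "h u \<in> K1" "h u \<in> K2" "h u \<in> K3" unfolding K using s u by (force, force, auto)
    ultimately show "K1 \<inter> K3 = {h u}" "K2 \<inter> K3 = {h u}" by auto
  qed
qed

text \<open>
  Up to the last parameter \<open>u\<close> before \<open>s\<close> with \<open>g u\<close> in the closure of \<open>F\<close>, the arc dangles from the rest
  and does not separate; so points of the arc just beyond \<open>g u\<close> would belong to \<open>F\<close>.
\<close>

lemma frontier_arc_right:
  fixes S F :: "complex set"
  assumes "compact S" and g: "arc g" "S \<inter> path_image g = {g 0, g 1}"
    and F: "F \<inter> (S \<union> path_image g) = {}" "frontier F \<subseteq> S \<union> path_image g"
    and rs: "0 < r" "r < s" "s < 1" "g r \<in> closure F"
  shows "g s \<in> closure F"
proof (rule ccontr)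
  assume neg: "g s \<notin> closure F"
  have gc: "continuous_on {0..1} g" and ginj: "inj_on g {0..1}"
    using g by (auto simp: arc_def path_def)
  have grs: "continuous_on {r..s} g" using rs by (intro continuous_on_subset[OF gc]) auto
  let ?T = "{r..s} \<inter> g -` closure F"
  have "compact ?T"
    using continuous_closed_preimage[OF grs, of "closure F"]
    by (auto simp: compact_eq_bounded_closed bounded_Int)
  moreover have "r \<in> ?T" using rs by simp
  ultimately obtain u where u: "u \<in> ?T" and umax: "\<And>t. t \<in> ?T \<Longrightarrow> t \<le> u"
    by (metis compact_attains_sup empty_iff)
  have us: "u < s" using u neg by (cases "u = s") auto
  have u01: "0 < u" "u < 1" using u us rs by auto
  have im: "path_image g = g ` {0..1}" by (simp add: path_image_def)
  let ?A = "g ` {0..u}" and ?S = "S \<union> g ` {s..1}"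
  have A: "arc_set ?A (g 0) (g u)"
    unfolding arc_set_def using g u01
    by (intro exI[of _ "subpath 0 u g"]) (auto intro: arc_subpath_arc simp: path_image_subpath)
  have gin: "g t \<notin> S" if "0 < t" "t < 1" for t
  proof
    assume "g t \<in> S"
    then have "g t \<in> {g 0, g 1}" using g(2) that im by auto
    then show False using ginj that by (auto dest!: inj_onD)
  qed
  have SA: "?S \<inter> ?A = {g 0}"
  proof
    show "?S \<inter> ?A \<subseteq> {g 0}"
    proof
      fix x assume "x \<in> ?S \<inter> ?A"
      then obtain t where t: "0 \<le> t" "t \<le> u" "x = g t" "x \<in> ?S" by auto
      have "x \<notin> g ` {s..1}"
        using t us u01 rs ginj by (auto dest!: inj_onD)
      then have "t = 0" using gin[of t] t u01 by (cases "t = 0") auto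
      then show "x \<in> {g 0}" using t by simp
    qed
    show "{g 0} \<subseteq> ?S \<inter> ?A" using g(2) u01 by auto
  qed
  have cS: "compact ?S"
    using assms(1) rs by (intro compact_Un compact_continuous_image continuous_on_subset[OF gc]) auto
  have "g u \<notin> ?S"
  proof -
    have "g u \<notin> g ` {s..1}" using us u01 rs ginj by (auto dest!: inj_onD)
    then show ?thesis using gin u01 by auto
  qed
  then obtain d where d: "d > 0" "ball (g u) d \<inter> ?S = {}"
    using compact_imp_closed[OF cS] by (metis ComplI disjoint_eq_subset_Compl open_Compl openE)
  obtain x where x: "x \<in> F" "x \<in> ball (g u) d"
    using u d(1) closure_approachable[of "g u" F] by (auto simp: dist_commute)
  have "\<exists>e>0. \<forall>t\<in>{0..1}. dist t u < e \<longrightarrow> dist (g t) (g u) < d"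
    using gc u01 d(1) unfolding continuous_on_iff by (metis atLeastAtMost_iff less_imp_le)
  then obtain e where e: "e > 0" "\<And>t. t \<in> {0..1} \<Longrightarrow> dist t u < e \<Longrightarrow> dist (g t) (g u) < d"
    by blast
  define t where "t = min ((u + s) / 2) (u + e / 2)"
  have t: "u < t" "t < s" "dist t u < e" using us e unfolding t_def by (auto simp: dist_real_def min_def)
  have y: "g t \<in> ball (g u) d" using e(2)[of t] t u01 rs by (auto simp: dist_commute)
  have "g t \<notin> ?A" using t u01 rs ginj by (auto dest!: inj_onD)
  have "connected_component (- ?S) x (g t)"
    unfolding connected_component_def using d x y by (intro exI[of _ "ball (g u) d"]) auto
  moreover have "connected_component (- ?A) x (g t)"
  proof -
    have "x \<notin> ?A" using x(1) F(1) u01 im by auto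
    then show ?thesis
      unfolding connected_component_def using \<open>g t \<notin> ?A\<close> arc_set_connected_Compl[OF A]
      by (intro exI[of _ "- ?A"]) auto
  qed
  ultimately have cc: "connected_component (- (?S \<union> ?A)) x (g t)"
    using Janiszewski[OF cS compact_imp_closed[OF arc_set_compact[OF A]]] SA by simp
  have "frontier F \<subseteq> ?S \<union> ?A"
  proof
    fix z assume z: "z \<in> frontier F"
    then have zF: "z \<in> closure F" by (simp add: frontier_def)
    show "z \<in> ?S \<union> ?A"
    proof (cases "z \<in> S")
      case False
      then obtain v where v: "z = g v" "v \<in> {0..1}" using z F(2) im by auto
      have "\<not> (u < v \<and> v < s)" using umax[of v] v zF u by auto
      then show ?thesis using v by (cases "v \<le> u") auto
    qed auto
  qed
  from connected_component_in_frontier[OF cc x(1) this] have "g t \<in> F" .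
  then show False using F(1) t u01 rs im by auto
qed

text \<open>From \<open>p\<close>, membership in the closure spreads forwards along the arc, and
  backwards by applying the same lemma to the reversed arc. The two ends follow because the closure
  is closed.\<close>

lemma arc_set_subset_closure:
  assumes "compact S" and K: "arc_set K a b" "S \<inter> K = {a, b}"
    and F: "F \<inter> (S \<union> K) = {}" "frontier F \<subseteq> S \<union> K"
    and p: "p \<in> K - {a, b}" "p \<in> closure F"
  shows "K \<subseteq> closure F"
proof -
  obtain g where g: "arc g" "pathstart g = a" "pathfinish g = b" "path_image g = K"
    using K arc_set_def by auto
  have KI: "K - {a, b} = g ` {0<..<1}" using arc_image_interior(1)[OF g(1-3)] g(4) by simp
  let ?h = "reversepath g"
  have ab: "a = g 0" "b = g 1" using g by (auto simp: pathstart_def pathfinish_def)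
  have h: "arc ?h" "path_image ?h = K" "?h 0 = b" "?h 1 = a"
    using g by (auto simp: arc_reversepath ab) (auto simp: reversepath_def)
  obtain r where r: "0 < r" "r < 1" "p = g r" using p KI by auto
  have "g s \<in> closure F" if s: "0 < s" "s < 1" for s
  proof -
    consider "s < r" | "s = r" | "r < s" by linarith
    then show ?thesis
    proof cases
      case 1
      have "?h (1 - s) \<in> closure F"
      proof (rule frontier_arc_right[OF assms(1) h(1)])
        show "?h (1 - r) \<in> closure F" using p r by (simp add: reversepath_def)
      qed (use 1 r s h F K in auto)
      then show ?thesis by (simp add: reversepath_def)
    next
      case 3
      show ?thesis
        using frontier_arc_right[OF assms(1) g(1), of F r s] 3 r s g(4) ab F K p by simp
    qed (use p r in auto)
  qed
  then have "K - {a, b} \<subseteq> closure F" unfolding KI by auto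
  then show ?thesis
    using arc_set_interior(3)[OF K(1)] closure_minimal by (metis closed_closure order_trans)
qed

text \<open>The component of the complement of the theta curve that contains \<open>W\<close>
  already touches \<open>K1\<close> and \<open>K2\<close>, hence not the interior of
  \<open>K3\<close>. Its frontier then lies in \<open>K1 \<union> K2\<close>, so it would have to
  contain every point that this curve does not separate from \<open>x\<close>, in particular the
  point \<open>y\<close> of \<open>K3\<close>.\<close>

lemma theta_side:
  assumes K: "arc_set K1 a b" "arc_set K2 a b" "arc_set K3 a b"
    and I: "K1 \<inter> K2 = {a, b}" "K1 \<inter> K3 = {a, b}" "K2 \<inter> K3 = {a, b}"
    and W: "connected W" "W \<inter> (K1 \<union> K2 \<union> K3) = {}"
    and cl: "closure W \<inter> (K1 - {a, b}) \<noteq> {}" "closure W \<inter> (K2 - {a, b}) \<noteq> {}"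
    and xy: "x \<in> W" "y \<in> K3 - {a, b}"
  shows "\<not> connected_component (- (K1 \<union> K2)) x y"
proof
  assume cc: "connected_component (- (K1 \<union> K2)) x y"
  let ?T = "K1 \<union> K2 \<union> K3"
  let ?C = "connected_component_set (- ?T) x"
  have xT: "x \<in> - ?T" using xy W by blast
  have WC: "W \<subseteq> ?C" using W xy by (intro connected_component_maximal) auto
  have closedT: "closed ?T" using K by (intro closed_Un) (auto intro: arc_set_compact compact_imp_closed)
  have "frontier ?C \<subseteq> ?T"
    using frontier_of_components_closed_complement[OF closedT] xT by (auto simp: components_def)
  moreover have CT: "?C \<inter> ?T = {}" using connected_component_subset by blast
  moreover have "closure ?C \<inter> (K3 - {a, b}) = {}"
    using theta_component[OF K I, of ?C] CT cl closure_mono[OF WC] by blast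
  ultimately have "frontier ?C \<subseteq> K1 \<union> K2"
    using arc_set_ends[OF K(1)] unfolding frontier_def by blast
  then have "y \<in> ?C" using connected_component_in_frontier[OF cc, of ?C] xT by simp
  then show False using CT xy by blast
qed

lemma less3_cases: "i < 3 \<longleftrightarrow> i = 0 \<or> i = 1 \<or> i = (2::nat)"
  by auto

lemma path_connected_Un_family:
  assumes "finite I" "path_connected P" "\<And>i. i \<in> I \<Longrightarrow> path_connected (B i)"
    "\<And>i. i \<in> I \<Longrightarrow> P \<inter> B i \<noteq> {}"
  shows "path_connected (P \<union> \<Union>(B ` I))"
  using assms
proof (induction I)
  case (insert i I)
  have "path_connected (P \<union> \<Union>(B ` I))" using insert by simp
  moreover have "path_connected (B i)" "P \<inter> B i \<noteq> {}" using insert.prems by simp_all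
  ultimately have "path_connected ((P \<union> \<Union>(B ` I)) \<union> B i)"
    by (metis (no_types, lifting) Int_Un_distrib2 path_connected_Un sup_eq_bot_iff)
  moreover have "(P \<union> \<Union>(B ` I)) \<union> B i = P \<union> \<Union>(B ` insert i I)" by auto
  ultimately show ?case by simp
qed simp

lemma path_connected_arc_set:
  assumes "path_connected S" "x \<in> S" "y \<in> S" "x \<noteq> y"
  shows "\<exists>K\<subseteq>S. arc_set K x y"
  using assms unfolding path_connected_arcwise arc_set_def by metis

text \<open>Each leaf \<open>l i\<close> lies on its own leg only and off the core \<open>P\<close>,
  so deleting leaves merely shortens legs and keeps the union path connected. This is what
  \<open>tripod\<close> asks for.\<close>

lemma star_tripod:
  assumes P: "path_connected P"
    and arcs: "\<And>i. i < 3 \<Longrightarrow> arc_set (\<alpha> i) (l i) (a i)"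
    and aP: "\<And>i. i < 3 \<Longrightarrow> a i \<in> P" and lP: "\<And>i. i < 3 \<Longrightarrow> l i \<notin> P"
    and sep: "\<And>i j. i < 3 \<Longrightarrow> j < 3 \<Longrightarrow> i \<noteq> j \<Longrightarrow> l i \<notin> \<alpha> j"
  shows "\<exists>c K. (\<forall>i<3. arc_set (K i) (l i) c \<and> K i \<subseteq> P \<union> \<Union>(\<alpha> ` {..<3::nat})) \<and>
    (\<forall>i<3. \<forall>j<3. i \<noteq> j \<longrightarrow> K i \<inter> K j = {c})"
proof -
  let ?X = "P \<union> \<Union>(\<alpha> ` {..<3::nat})"
  have pc: "path_connected (?X - l ` J)" if J: "J \<subseteq> {..<3}" for J
  proof -
    define B where "B i = (if i \<in> J then \<alpha> i - {l i} else \<alpha> i)" for i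
    have "path_connected (P \<union> \<Union>(B ` {..<3}))"
    proof (rule path_connected_Un_family[OF _ P])
      fix i :: nat assume i: "i \<in> {..<3}"
      then have ar: "arc_set (\<alpha> i) (l i) (a i)" using arcs by simp
      show "path_connected (B i)"
        unfolding B_def using arc_set_path_connected[OF ar] arc_set_path_connected_delete[OF ar] by simp
      have "a i \<in> P \<inter> B i" unfolding B_def using aP i arc_set_ends[OF ar] by auto
      then show "P \<inter> B i \<noteq> {}" by blast
    qed simp
    moreover have "P \<union> \<Union>(B ` {..<3}) = ?X - l ` J"
    proof (rule set_eqI)
      fix x
      show "x \<in> P \<union> \<Union>(B ` {..<3}) \<longleftrightarrow> x \<in> ?X - l ` J"
      proof (cases "x \<in> l ` J")
        case True
        then obtain i where "i \<in> J" "x = l i" by blast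
        then show ?thesis using J lP sep unfolding B_def by (auto split: if_splits; blast)
      next
        case False
        then show ?thesis unfolding B_def by (auto split: if_splits)
      qed
    qed
    ultimately show ?thesis by simp
  qed
  have mem: "l i \<in> \<alpha> i" if "i < 3" for i using arc_set_ends[OF arcs[OF that]] by blast
  have ne: "l i \<noteq> l j" if "i < 3" "j < 3" "i \<noteq> j" for i j
    using sep[OF that] mem[OF that(2)] by auto
  have "path_connected (?X - {l 2})" "path_connected (?X - {l 0, l 1})"
    using pc[of "{2}"] pc[of "{0, 1}"] by auto
  moreover have "l 0 \<in> ?X" "l 1 \<in> ?X" "l 2 \<in> ?X" using mem[of 0] mem[of 1] mem[of 2] by force+
  moreover have "l 0 \<noteq> l 1" "l 0 \<noteq> l 2" "l 1 \<noteq> l 2" by (rule ne; simp)+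
  ultimately obtain c K1 K2 K3 where K: "arc_set K1 (l 0) c" "arc_set K2 (l 1) c" "arc_set K3 (l 2) c"
    "K1 \<union> K2 \<union> K3 \<subseteq> ?X" "K1 \<inter> K2 = {c}" "K1 \<inter> K3 = {c}" "K2 \<inter> K3 = {c}"
    by (rule tripod)
  define K where "K = (\<lambda>i::nat. if i = 0 then K1 else if i = 1 then K2 else K3)"
  show ?thesis
  proof (intro exI conjI allI impI)
    fix i :: nat assume "i < 3"
    then show "arc_set (K i) (l i) c" "K i \<subseteq> ?X"
      using K(1-4) unfolding K_def less3_cases by auto
  next
    fix i j :: nat assume "i < 3" "j < 3" "i \<noteq> j"
    then show "K i \<inter> K j = {c}" using K(5-7) unfolding K_def less3_cases by auto
  qed
qed

section \<open>Minors and cycles of outerplanar graphs\<close>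

text \<open>The two sets need not form a subgraph: the ends of an edge come with its curve, whether
  or not they are listed in \<open>VS\<close>.\<close>

definition subskel :: "('v, 'e) drawing \<Rightarrow> 'v set \<Rightarrow> 'e set \<Rightarrow> complex set" where
  "subskel D VS ES = point D ` VS \<union> (\<Union>e\<in>ES. path_image (curve D e))"

locale plane_graph =
  fixes G :: "('v, 'e) multigraph" and D :: "('v, 'e) drawing"
  assumes finite_multigraph: "finite_multigraph G" and plane_drawing: "plane_drawing G D"
begin

abbreviation pt where "pt \<equiv> point D"
abbreviation im where "im e \<equiv> path_image (curve D e)"

lemma ends_verts: "e \<in> edges G \<Longrightarrow> ends G e \<subseteq> verts G"
  and ends_nonempty: "e \<in> edges G \<Longrightarrow> ends G e \<noteq> {}"
  using finite_multigraph unfolding finite_multigraph_def by force+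

lemma pt_eq: "u \<in> verts G \<Longrightarrow> v \<in> verts G \<Longrightarrow> pt u = pt v \<longleftrightarrow> u = v"
  using plane_drawing unfolding plane_drawing_def by (metis inj_onD)

lemma im_verts: "e \<in> edges G \<Longrightarrow> im e \<inter> pt ` verts G = pt ` ends G e"
  using plane_drawing unfolding plane_drawing_def by blast

lemma im_Int: "e \<in> edges G \<Longrightarrow> f \<in> edges G \<Longrightarrow> e \<noteq> f \<Longrightarrow> im e \<inter> im f \<subseteq> pt ` verts G"
  using plane_drawing unfolding plane_drawing_def by blast

lemma pt_in_im: "e \<in> edges G \<Longrightarrow> v \<in> verts G \<Longrightarrow> pt v \<in> im e \<longleftrightarrow> v \<in> ends G e"
  using im_verts[of e] pt_eq ends_verts[of e] by blast

lemma path_im: "e \<in> edges G \<Longrightarrow> path (curve D e)"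
  using plane_drawing unfolding plane_drawing_def by (blast dest: simple_path_imp_path)

lemma edge_arc_set:
  assumes "e \<in> edges G" "ends G e = {u, v}" "u \<noteq> v"
  shows "arc_set (im e) (pt u) (pt v)"
proof -
  let ?g = "curve D e"
  have g: "simple_path ?g" "{pathstart ?g, pathfinish ?g} = {pt u, pt v}"
    using plane_drawing assms unfolding plane_drawing_def by auto
  have ne: "pt u \<noteq> pt v" using assms ends_verts[of e] pt_eq[of u v] by auto
  then have "arc ?g" using g by (metis doubleton_eq_iff insert_absorb2 simple_path_imp_arc)
  then have "arc_set (im e) (pathstart ?g) (pathfinish ?g)" unfolding arc_set_def by blast
  then show ?thesis using g(2) arc_set_sym by (metis doubleton_eq_iff)
qed

lemma pt_in_subskel:
  assumes "VS \<subseteq> verts G" "ES \<subseteq> edges G" "v \<in> verts G"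
  shows "pt v \<in> subskel D VS ES \<longleftrightarrow> v \<in> VS \<union> \<Union>(ends G ` ES)"
  using assms pt_in_im pt_eq unfolding subskel_def by (auto; blast)

text \<open>Parts of the drawing without a common edge meet only in vertex points, so an
  intersection of plane sets becomes one of vertex sets. The facts on how arcs of the cycle, chords
  and branch sets meet are derived from this.\<close>

lemma subskel_Int:
  assumes "VS \<subseteq> verts G" "ES \<subseteq> edges G" "VS' \<subseteq> verts G" "ES' \<subseteq> edges G" "ES \<inter> ES' = {}"
  shows "subskel D VS ES \<inter> subskel D VS' ES' =
    pt ` ((VS \<union> \<Union>(ends G ` ES)) \<inter> (VS' \<union> \<Union>(ends G ` ES')))" (is "?L = ?R")
proof
  show "?L \<subseteq> ?R"
  proof
    fix x assume x: "x \<in> ?L"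
    have "x \<in> pt ` verts G"
    proof (rule ccontr)
      assume "x \<notin> pt ` verts G"
      then obtain e f where "e \<in> ES" "f \<in> ES'" "x \<in> im e" "x \<in> im f"
        using x assms unfolding subskel_def by blast
      then show False using im_Int[of e f] assms \<open>x \<notin> pt ` verts G\<close> by blast
    qed
    then show "x \<in> ?R" using x assms pt_in_subskel by auto
  qed
  show "?R \<subseteq> ?L"
  proof
    fix x assume "x \<in> ?R"
    then obtain v where v: "x = pt v" "v \<in> VS \<union> \<Union>(ends G ` ES)" "v \<in> VS' \<union> \<Union>(ends G ` ES')"
      by blast
    then have "v \<in> verts G" using assms(1,2) ends_verts by blast
    then show "x \<in> ?L" using v pt_in_subskel assms(1-4) by simp
  qed
qed

definition induced_edges :: "'v set \<Rightarrow> 'e set" where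
  "induced_edges A = {e \<in> edges G. ends G e \<subseteq> A}"

lemma path_connected_subskel:
  assumes A: "A \<subseteq> verts G"
    and con: "\<And>u v. u \<in> A \<Longrightarrow> v \<in> A \<Longrightarrow> (u, v) \<in> (adjacency G \<inter> A \<times> A)\<^sup>*"
  shows "path_connected (subskel D A (induced_edges A))" (is "path_connected ?S")
proof -
  have edge: "path_component ?S x y" if "e \<in> induced_edges A" "x \<in> im e" "y \<in> im e" for e x y
  proof -
    have "path_connected (im e)"
      using that path_im by (auto simp: induced_edges_def path_connected_path_image)
    moreover have "im e \<subseteq> ?S" using that by (auto simp: subskel_def)
    ultimately show ?thesis
      using that by (meson path_component_of_subset path_connected_component)
  qed
  have vert: "path_component ?S (pt u) (pt v)" if "u \<in> A" "v \<in> A" for u v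
    using con[OF that]
  proof (induction rule: rtrancl_induct)
    case base
    show ?case using that by (intro path_component_refl) (auto simp: subskel_def)
  next
    case (step y z)
    then obtain e where e: "e \<in> edges G" "ends G e = {y, z}" "y \<in> A" "z \<in> A"
      unfolding adjacency_def by auto
    then have "path_component ?S (pt y) (pt z)"
      using A pt_in_im[OF e(1)] by (intro edge[of e]) (auto simp: induced_edges_def)
    then show ?case using step by (meson path_component_trans)
  qed
  have all: "\<exists>v\<in>A. path_component ?S x (pt v)" if xS: "x \<in> ?S" for x
  proof (cases "x \<in> pt ` A")
    case True
    then show ?thesis using vert by blast
  next
    case False
    then obtain e where e: "e \<in> induced_edges A" "x \<in> im e" using xS unfolding subskel_def by blast
    then obtain v where v: "v \<in> ends G e" "v \<in> A" "e \<in> edges G"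
      using ends_nonempty by (auto simp: induced_edges_def)
    then show ?thesis using edge[OF e, of "pt v"] pt_in_im A by blast
  qed
  show ?thesis
    unfolding path_connected_component
    using all vert by (meson path_component_sym path_component_trans)
qed

end

text \<open>The branch sets are \<open>A\<close> and \<open>B\<close> on one side of the bipartition
  and the three \<open>L i\<close> on the other. One tripod runs in \<open>A\<close> and its edges
  to the \<open>L i\<close>, another in \<open>B\<close>, the \<open>L i\<close> and the edges
  between them; they meet exactly in the leaves \<open>pt (l i)\<close>. Together they form a theta
  curve with a vertex in the interior of each arc. All these vertices are on the face
  \<open>Of\<close>, which \<open>theta_component\<close> forbids.\<close>

lemma (in plane_graph) no_K23_minor:
  fixes L :: "nat \<Rightarrow> 'v set"
  assumes O: "Of \<in> drawing_faces G D" "\<And>v. v \<in> verts G \<Longrightarrow> pt v \<in> frontier Of"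
    and sub: "A \<subseteq> verts G" "B \<subseteq> verts G" "\<And>i. i < 3 \<Longrightarrow> L i \<subseteq> verts G"
    and disj: "A \<inter> B = {}" "\<And>i. i < 3 \<Longrightarrow> A \<inter> L i = {}" "\<And>i. i < 3 \<Longrightarrow> B \<inter> L i = {}"
      "\<And>i j. i < 3 \<Longrightarrow> j < 3 \<Longrightarrow> i \<noteq> j \<Longrightarrow> L i \<inter> L j = {}"
    and conA: "\<And>u v. u \<in> A \<Longrightarrow> v \<in> A \<Longrightarrow> (u, v) \<in> (adjacency G \<inter> A \<times> A)\<^sup>*"
    and conB: "\<And>u v. u \<in> B \<Longrightarrow> v \<in> B \<Longrightarrow> (u, v) \<in> (adjacency G \<inter> B \<times> B)\<^sup>*"
    and conL: "\<And>i u v. i < 3 \<Longrightarrow> u \<in> L i \<Longrightarrow> v \<in> L i \<Longrightarrow> (u, v) \<in> (adjacency G \<inter> L i \<times> L i)\<^sup>*"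
    and AL: "\<And>i. i < 3 \<Longrightarrow> \<exists>e\<in>edges G. \<exists>u\<in>A. \<exists>l\<in>L i. ends G e = {u, l}"
    and BL: "\<And>i. i < 3 \<Longrightarrow> \<exists>e\<in>edges G. \<exists>u\<in>B. \<exists>l\<in>L i. ends G e = {u, l}"
  shows False
proof -
  obtain \<alpha> a l where al: "\<And>i. i < 3 \<Longrightarrow> \<alpha> i \<in> edges G \<and> a i \<in> A \<and> l i \<in> L i \<and> ends G (\<alpha> i) = {a i, l i}"
    using AL by metis
  obtain \<beta> b m where be: "\<And>i. i < 3 \<Longrightarrow> \<beta> i \<in> edges G \<and> b i \<in> B \<and> m i \<in> L i \<and> ends G (\<beta> i) = {b i, m i}"
    using BL by metis
  have mem: "a i \<in> A" "l i \<in> L i" "b i \<in> B" "m i \<in> L i" "\<alpha> i \<in> edges G" "\<beta> i \<in> edges G"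
    if "i < 3" for i
    using al[OF that] be[OF that] by simp_all
  have inV: "a i \<in> verts G" "l i \<in> verts G" "b i \<in> verts G" "m i \<in> verts G" if "i < 3" for i
    using mem[OF that] sub(1,2) sub(3)[OF that] by auto
  have ne: "a i \<noteq> l i" "b i \<noteq> m i" "b i \<noteq> l i" if "i < 3" for i
    using mem(1-4)[OF that] disj(1) disj(2)[OF that] disj(3)[OF that] by auto
  let ?PA = "subskel D A (induced_edges A)" and ?PB = "subskel D B (induced_edges B)"
  have indE: "induced_edges C \<subseteq> edges G" "\<Union>(ends G ` induced_edges C) \<subseteq> C" for C
    by (auto simp: induced_edges_def)
  have pt_ind: "pt v \<in> subskel D C (induced_edges C) \<longleftrightarrow> v \<in> C" if "C \<subseteq> verts G" "v \<in> verts G" for v C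
    using pt_in_subskel[OF that(1) indE(1) that(2)] indE(2)[of C] by blast
  \<comment> \<open>The edges from \<open>A\<close> and from \<open>B\<close> may enter
    \<open>L i\<close> at different vertices \<open>l i\<close> and \<open>m i\<close>, so the leg
    from \<open>l i\<close> towards \<open>B\<close> has to pass through \<open>L i\<close>.\<close>
  let ?Q = "\<lambda>i. subskel D (L i) (induced_edges (L i)) \<union> im (\<beta> i)"
  have "\<exists>K\<subseteq>?Q i. arc_set K (pt (l i)) (pt (b i))" if i: "i < 3" for i
  proof (rule path_connected_arc_set)
    have "pt (m i) \<in> subskel D (L i) (induced_edges (L i)) \<inter> im (\<beta> i)"
      using pt_ind[OF sub(3)[OF i] inV(4)[OF i]] pt_in_im[of "\<beta> i" "m i"] be[OF i] inV[OF i] by auto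
    then show "path_connected (?Q i)"
      using path_connected_subskel[OF sub(3)[OF i] conL[OF i]] path_im[of "\<beta> i"] be[OF i]
      by (intro path_connected_Un) (auto simp: path_connected_path_image)
    show "pt (l i) \<in> ?Q i" using al[OF i] by (simp add: subskel_def)
    show "pt (b i) \<in> ?Q i" using be[OF i] pt_in_im[of "\<beta> i" "b i"] inV[OF i] by simp
    show "pt (l i) \<noteq> pt (b i)" using pt_eq inV[OF i] ne[OF i] by simp
  qed
  then obtain \<gamma> where \<gamma>: "\<And>i. i < 3 \<Longrightarrow> \<gamma> i \<subseteq> ?Q i \<and> arc_set (\<gamma> i) (pt (l i)) (pt (b i))"
    by metis
  define EA where "EA = induced_edges A \<union> \<alpha> ` {..<3}"
  define EB where "EB = induced_edges B \<union> (\<Union>i<3. induced_edges (L i)) \<union> \<beta> ` {..<3}"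
  define VB where "VB = B \<union> (\<Union>i<3. L i)"
  have EAs: "EA \<subseteq> edges G" and EBs: "EB \<subseteq> edges G" and VBs: "VB \<subseteq> verts G"
    using indE(1) al be sub unfolding EA_def EB_def VB_def by (auto; blast)+
  have AVB: "A \<inter> VB = {}" using disj unfolding VB_def by blast
  have EBends: "VB \<union> \<Union>(ends G ` EB) \<subseteq> VB"
    using indE(2) be unfolding EB_def VB_def by (auto; blast)
  have EAends: "A \<union> \<Union>(ends G ` EA) \<subseteq> A \<union> l ` {..<3}"
    using indE(2)[of A] al unfolding EA_def by auto
  \<comment> \<open>Every edge of \<open>EA\<close> has an end in \<open>A\<close> and no edge of
    \<open>EB\<close> does. So the two halves share no edge and meet only in vertex points.\<close>
  have "ends G e \<inter> A \<noteq> {}" if "e \<in> EA" for e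
  proof (cases "e \<in> induced_edges A")
    case True
    then show ?thesis using ends_nonempty[of e] unfolding induced_edges_def by blast
  next
    case False
    then obtain i where "i < 3" "e = \<alpha> i" using \<open>e \<in> EA\<close> unfolding EA_def by blast
    then show ?thesis using al[of i] by auto
  qed
  then have dis: "EA \<inter> EB = {}" using EBends AVB by blast
  let ?X = "?PA \<union> \<Union>((\<lambda>i. im (\<alpha> i)) ` {..<3})" and ?Y = "?PB \<union> \<Union>(\<gamma> ` {..<3})"
  have X: "?X = subskel D A EA" unfolding EA_def subskel_def by auto
  have Y: "?Y \<subseteq> subskel D VB EB"
    using \<gamma> unfolding EB_def VB_def subskel_def by (auto; blast)
  have XY: "?X \<inter> ?Y \<subseteq> pt ` l ` {..<3}"
  proof -
    have "subskel D A EA \<inter> subskel D VB EB \<subseteq> pt ` l ` {..<3}"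
      unfolding subskel_Int[OF sub(1) EAs VBs EBs dis]
      using EAends EBends AVB by (intro image_mono) blast
    then show ?thesis using X Y by blast
  qed
  have arcA: "arc_set (im (\<alpha> i)) (pt (l i)) (pt (a i))" if "i < 3" for i
    using edge_arc_set[of "\<alpha> i" "a i" "l i"] al[OF that] ne[OF that] arc_set_sym by blast
  have "\<exists>c K. (\<forall>i<3. arc_set (K i) (pt (l i)) c \<and> K i \<subseteq> ?X) \<and>
    (\<forall>i<3. \<forall>j<3. i \<noteq> j \<longrightarrow> K i \<inter> K j = {c})"
  proof (rule star_tripod[OF path_connected_subskel[OF sub(1) conA]])
    fix i :: nat assume i: "i < 3"
    show "arc_set (im (\<alpha> i)) (pt (l i)) (pt (a i))" using arcA[OF i] .
    show "pt (a i) \<in> ?PA" using al[OF i] by (simp add: subskel_def)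
    show "pt (l i) \<notin> ?PA" using pt_ind[OF sub(1)] al[OF i] inV[OF i] disj(2)[OF i] by blast
    show "pt (l i) \<notin> im (\<alpha> j)" if j: "j < 3" "i \<noteq> j" for j
      using pt_in_im[of "\<alpha> j" "l i"] al[OF i] al[OF j(1)] inV[OF i] disj(2)[OF i] disj(4)[OF i j] by auto
  qed auto
  then obtain c K where K0: "(\<forall>i<3. arc_set (K i) (pt (l i)) c \<and> K i \<subseteq> ?X) \<and>
    (\<forall>i<3. \<forall>j<3. i \<noteq> j \<longrightarrow> K i \<inter> K j = {c})"
    by (elim exE)
  note K = K0[THEN conjunct1, rule_format, THEN conjunct1]
    K0[THEN conjunct1, rule_format, THEN conjunct2] K0[THEN conjunct2, rule_format]
  have "\<exists>d H. (\<forall>i<3. arc_set (H i) (pt (l i)) d \<and> H i \<subseteq> ?Y) \<and>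
    (\<forall>i<3. \<forall>j<3. i \<noteq> j \<longrightarrow> H i \<inter> H j = {d})"
  proof (rule star_tripod[OF path_connected_subskel[OF sub(2) conB]])
    fix i :: nat assume i: "i < 3"
    show "arc_set (\<gamma> i) (pt (l i)) (pt (b i))" using \<gamma>[OF i] by blast
    show "pt (b i) \<in> ?PB" using be[OF i] by (simp add: subskel_def)
    show "pt (l i) \<notin> ?PB" using pt_ind[OF sub(2)] al[OF i] inV[OF i] disj(3)[OF i] by blast
    show "pt (l i) \<notin> \<gamma> j" if j: "j < 3" "i \<noteq> j" for j
    proof -
      have "pt (l i) \<notin> im (\<beta> j)"
        using pt_in_im[of "\<beta> j" "l i"] al[OF i] be[OF j(1)] inV[OF i] disj(3)[OF i] disj(4)[OF i j] by auto
      moreover have "pt (l i) \<notin> subskel D (L j) (induced_edges (L j))"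
        using pt_ind[OF sub(3)[OF j(1)] inV(2)[OF i]] al[OF i] disj(4)[OF i j] by blast
      ultimately show ?thesis using \<gamma>[OF j(1)] by blast
    qed
  qed auto
  then obtain d H where H0: "(\<forall>i<3. arc_set (H i) (pt (l i)) d \<and> H i \<subseteq> ?Y) \<and>
    (\<forall>i<3. \<forall>j<3. i \<noteq> j \<longrightarrow> H i \<inter> H j = {d})"
    by (elim exE)
  note H = H0[THEN conjunct1, rule_format, THEN conjunct1]
    H0[THEN conjunct1, rule_format, THEN conjunct2] H0[THEN conjunct2, rule_format]
  have lK: "pt (l i) \<in> K i" "pt (l i) \<noteq> c" "c \<in> K i" if "i < 3" for i
    using arc_set_ends[OF K(1)[OF that]] by blast+
  have lH: "pt (l i) \<in> H i" "pt (l i) \<noteq> d" "d \<in> H i" if "i < 3" for i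
    using arc_set_ends[OF H(1)[OF that]] by blast+
  have lK': "pt (l i) \<notin> K j" and lH': "pt (l i) \<notin> H j" if "i < 3" "j < 3" "i \<noteq> j" for i j
    using K(3)[OF that] lK[OF that(1)] H(3)[OF that] lH[OF that(1)] by blast+
  have KH: "K i \<inter> H j \<subseteq> pt ` l ` {..<3}" if "i < 3" "j < 3" for i j
    using K(2)[OF that(1)] H(2)[OF that(2)] XY by blast
  have KHi: "K i \<inter> H i = {pt (l i)}" if i: "i < 3" for i
  proof -
    have "x = pt (l i)" if x: "x \<in> K i \<inter> H i" for x
    proof -
      obtain k where "k < 3" "x = pt (l k)" using KH[OF i i] x by blast
      then show ?thesis using lK'[of k i] i x by (cases "k = i") auto
    qed
    then show ?thesis using lK(1)[OF i] lH(1)[OF i] by blast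
  qed
  have KHij: "K i \<inter> H j = {}" if ij: "i < 3" "j < 3" "i \<noteq> j" for i j
  proof -
    have False if x: "x \<in> K i \<inter> H j" for x
    proof -
      obtain k where "k < 3" "x = pt (l k)" using KH[OF ij(1,2)] x by blast
      then show ?thesis using lK'[of k i] lH'[of k j] ij x by (cases "k = i") auto
    qed
    then show ?thesis by blast
  qed
  have cd: "c \<noteq> d"
  proof
    assume "c = d"
    then have "c \<in> K 0 \<inter> H 0" using lK(3)[of 0] lH(3)[of 0] by simp
    then show False using KHi[of 0] lK(2)[of 0] by simp
  qed
  define C where "C i = K i \<union> H i" for i
  have C: "arc_set (C i) c d" if "i < 3" for i
    unfolding C_def using arc_set_join[OF arc_set_sym[OF K(1)[OF that]] H(1)[OF that] KHi[OF that]] .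
  have CI: "C i \<inter> C j = {c, d}" if ij: "i < 3" "j < 3" "i \<noteq> j" for i j
    unfolding C_def
    using K(3)[OF ij] H(3)[OF ij] KHij[OF ij] KHij[OF ij(2,1) ij(3)[symmetric]] by blast
  have lC: "pt (l i) \<in> C i - {c, d}" if "i < 3" for i
    unfolding C_def using lK[OF that] lH[OF that] by blast
  have clO: "closure Of \<inter> (C i - {c, d}) \<noteq> {}" if "i < 3" for i
    using lC[OF that] O(2)[of "l i"] inV(2)[OF that] unfolding frontier_def by blast
  have sk: "subskel D VS ES \<subseteq> skeleton G D" if "VS \<subseteq> verts G" "ES \<subseteq> edges G" for VS ES
    using that unfolding subskel_def skeleton_def by blast
  have "Of \<inter> skeleton G D = {}" "connected Of"
    using O(1) in_components_subset in_components_connected unfolding drawing_faces_def by blast+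
  moreover have "C i \<subseteq> skeleton G D" if "i < 3" for i
    using K(2)[OF that] H(2)[OF that] X Y sk[OF sub(1) EAs] sk[OF VBs EBs] unfolding C_def by blast
  ultimately have "Of \<inter> (C 0 \<union> C 1 \<union> C 2) = {}" "connected Of"
    by (auto simp: less3_cases)
  then show False
    using theta_component[OF C[of 0] C[of 1] C[of 2] CI[of 0 1] CI[of 0 2] CI[of 1 2] _ _ clO[of 0] clO[of 1] clO[of 2]]
    by simp
qed

section \<open>Walks and Hamiltonian cycles of 2-connected outerplanar graphs\<close>

lemma adjacency_sym: "(u, v) \<in> adjacency G \<Longrightarrow> (v, u) \<in> adjacency G"
  unfolding adjacency_def by (auto simp: insert_commute)

lemma adjacency_delete_verts:
  "(x, y) \<in> adjacency (delete_verts G X) \<longleftrightarrow> (x, y) \<in> adjacency G \<and> x \<notin> X \<and> y \<notin> X"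
  unfolding adjacency_def delete_verts_def by auto

abbreviation walk :: "('v, 'e) multigraph \<Rightarrow> 'v list \<Rightarrow> bool" where
  "walk G \<equiv> successively (\<lambda>x y. (x, y) \<in> adjacency G)"

text \<open>An edge counts as a cycle of length two, so that a longest cycle always exists.\<close>

definition graph_cycle :: "('v, 'e) multigraph \<Rightarrow> 'v list \<Rightarrow> bool" where
  "graph_cycle G w \<longleftrightarrow> distinct w \<and> 2 \<le> length w \<and> set w \<subseteq> verts G \<and> walk G w \<and>
     (last w, hd w) \<in> adjacency G"

lemma walk_connected:
  assumes "walk G p" "x \<in> set p" "y \<in> set p"
  shows "(x, y) \<in> (adjacency G \<inter> set p \<times> set p)\<^sup>*"
proof -
  have hd: "(hd p, x) \<in> (adjacency G \<inter> set p \<times> set p)\<^sup>*" if "walk G p" "x \<in> set p" for p x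
    using that
  proof (induction p)
    case (Cons a q)
    show ?case
    proof (cases "x = a")
      case False
      then have xq: "x \<in> set q" using Cons.prems by simp
      then have ne: "q \<noteq> []" by auto
      then have q: "walk G q" "(a, hd q) \<in> adjacency G"
        using Cons.prems(1) by (auto simp: successively_Cons)
      have "(hd q, x) \<in> (adjacency G \<inter> set (a # q) \<times> set (a # q))\<^sup>*"
        using Cons.IH[OF q(1) xq] by (rule subsetD[OF rtrancl_mono, rotated]) auto
      moreover have "(a, hd q) \<in> adjacency G \<inter> set (a # q) \<times> set (a # q)"
        using q(2) ne by simp
      ultimately show ?thesis by (simp add: converse_rtrancl_into_rtrancl)
    qed simp
  qed simp
  have "sym ((adjacency G \<inter> set p \<times> set p)\<^sup>*)"
    by (rule sym_rtrancl) (auto simp: sym_def intro: adjacency_sym)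
  then show ?thesis
    using hd[OF assms(1,2)] hd[OF assms(1,3)] by (meson rtrancl_trans symD)
qed

text \<open>The walk stops just before it enters \<open>S\<close>. If prepending \<open>x\<close>
  would repeat a vertex, the part of the walk before the earlier occurrence of \<open>x\<close> is
  cut off instead, which keeps it a path.\<close>

lemma rtrancl_first_hit:
  assumes "(x, y) \<in> r\<^sup>*" "x \<notin> S" "y \<in> S"
  obtains p v where "p \<noteq> []" "hd p = x" "distinct p" "successively (\<lambda>x y. (x, y) \<in> r) p"
    "set p \<inter> S = {}" "set p \<subseteq> insert x (Range r)" "(last p, v) \<in> r" "v \<in> S"
proof -
  have "\<exists>p v. p \<noteq> [] \<and> hd p = x \<and> distinct p \<and> successively (\<lambda>x y. (x, y) \<in> r) p \<and>
    set p \<inter> S = {} \<and> set p \<subseteq> insert x (Range r) \<and> (last p, v) \<in> r \<and> v \<in> S"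
    using assms
  proof (induction rule: converse_rtrancl_induct)
    case (step x z)
    show ?case
    proof (cases "z \<in> S")
      case True
      then show ?thesis using step by (intro exI[of _ "[x]"] exI[of _ z]) auto
    next
      case False
      then obtain p v where p: "p \<noteq> []" "hd p = z" "distinct p" "successively (\<lambda>x y. (x, y) \<in> r) p"
        "set p \<inter> S = {}" "set p \<subseteq> insert z (Range r)" "(last p, v) \<in> r" "v \<in> S"
        using step.IH step.prems by blast
      have zr: "z \<in> Range r" using step.hyps(1) by blast
      show ?thesis
      proof (cases "x \<in> set p")
        case True
        then obtain p1 p2 where "p = p1 @ x # p2" by (meson split_list)
        then show ?thesis
          using p zr by (intro exI[of _ "x # p2"] exI[of _ v]) (auto simp: successively_append_iff)
      next
        case False
        then show ?thesis
          using p zr step by (intro exI[of _ "x # p"] exI[of _ v]) (auto simp: successively_Cons)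
      qed
    qed
  qed simp
  then show ?thesis using that by blast
qed

lemma graph_cycle_rotate:
  assumes "graph_cycle G (a @ u # b)"
  shows "graph_cycle G (u # b @ a)"
  using assms unfolding graph_cycle_def
  by (cases "a = []"; cases "b = []") (auto simp: successively_append_iff successively_Cons)

text \<open>Suppose a longest cycle misses a vertex. Then some \<open>x\<close> off the cycle is
  adjacent to a vertex \<open>u\<close> on it, and since deleting \<open>u\<close> leaves the graph
  connected, a path \<open>p\<close> leads from \<open>x\<close> to a neighbour of another cycle
  vertex \<open>v\<close>, avoiding \<open>u\<close>. If \<open>u\<close> and \<open>v\<close> are
  consecutive, a detour along \<open>p\<close> lengthens the cycle. Otherwise the two parts of the
  cycle between \<open>u\<close> and \<open>v\<close>, together with \<open>p\<close>, are the three
  middle branch sets of a K23 minor.\<close>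

lemma (in plane_graph) hamiltonian_cycle:
  assumes O: "Of \<in> drawing_faces G D" "\<And>v. v \<in> verts G \<Longrightarrow> pt v \<in> frontier Of"
    and con: "k_connected 2 G"
  obtains w where "graph_cycle G w" "set w = verts G"
proof -
  have card: "card (verts G) > 2" and fin: "finite (verts G)"
    using con finite_multigraph unfolding k_connected_def finite_multigraph_def by auto
  have del: "connected_graph (delete_verts G X)" if "X \<subseteq> verts G" "card X < 2" for X
    using con that unfolding k_connected_def by blast
  have reach: "(x, y) \<in> (adjacency (delete_verts G X))\<^sup>*"
    if "X \<subseteq> verts G" "card X < 2" "x \<in> verts G - X" "y \<in> verts G - X" for X x y
    using del[OF that(1,2)] that(3,4) unfolding connected_graph_def delete_verts_def by simp
  have adjV: "u \<in> verts G" "v \<in> verts G" if "(u, v) \<in> adjacency G" for u v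
    using that ends_verts unfolding adjacency_def by auto
  obtain u0 v0 where uv: "u0 \<in> verts G" "v0 \<in> verts G" "u0 \<noteq> v0"
  proof -
    have "\<not> card (verts G) \<le> Suc 0" using card by simp
    then show ?thesis using that unfolding card_le_Suc0_iff_eq[OF fin] by blast
  qed
  have r0: "(u0, v0) \<in> (adjacency (delete_verts G {}))\<^sup>*" "u0 \<notin> {v0}" "v0 \<in> {v0}"
    using reach[of "{}" u0 v0] uv by simp_all
  obtain p v where p0: "p \<noteq> []" "hd p = u0" "distinct p"
    "successively (\<lambda>x y. (x, y) \<in> adjacency (delete_verts G {})) p"
    "set p \<inter> {v0} = {}" "set p \<subseteq> insert u0 (Range (adjacency (delete_verts G {})))"
    "(last p, v) \<in> adjacency (delete_verts G {})" "v \<in> {v0}"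
    by (rule rtrancl_first_hit[OF r0])
  have "last p \<in> set p" using p0(1) by simp
  then have e: "(last p, v0) \<in> adjacency G" "last p \<noteq> v0"
    using p0(5,7,8) by (auto simp: adjacency_delete_verts)
  have "graph_cycle G [last p, v0]"
    using e adjV[OF e(1)] adjacency_sym[OF e(1)] by (simp add: graph_cycle_def)
  moreover have "length w < Suc (card (verts G))" if "graph_cycle G w" for w
    using that card_mono[OF fin, of "set w"] by (simp add: graph_cycle_def distinct_card)
  ultimately obtain w where w: "graph_cycle G w" and
    max: "\<And>w'. graph_cycle G w' \<Longrightarrow> length w' \<le> length w"
    using ex_has_greatest_nat[of "graph_cycle G" _ length "Suc (card (verts G))"] by metis
  have "set w = verts G"
  proof (rule ccontr)
    assume "set w \<noteq> verts G"
    then obtain x0 where x0: "x0 \<in> verts G" "x0 \<notin> set w" using w by (auto simp: graph_cycle_def)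
    obtain y0 where y0: "y0 \<in> set w" "y0 \<in> verts G"
      using w by (cases w) (auto simp: graph_cycle_def)
  have r1: "(x0, y0) \<in> (adjacency (delete_verts G {}))\<^sup>*" "x0 \<notin> set w" "y0 \<in> set w"
    using reach[of "{}" x0 y0] x0 y0 by simp_all
  obtain q u where qu: "q \<noteq> []" "hd q = x0" "distinct q"
    "successively (\<lambda>x y. (x, y) \<in> adjacency (delete_verts G {})) q"
    "set q \<inter> set w = {}" "set q \<subseteq> insert x0 (Range (adjacency (delete_verts G {})))"
    "(last q, u) \<in> adjacency (delete_verts G {})" "u \<in> set w"
    by (rule rtrancl_first_hit[OF r1])
    define x where "x = last q"
    have x: "x \<notin> set w" "(x, u) \<in> adjacency G"
    proof -
      have "last q \<in> set q" using qu(1) by simp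
      then show "x \<notin> set w" using qu(5) unfolding x_def by blast
      show "(x, u) \<in> adjacency G" using qu(7) unfolding x_def by (simp add: adjacency_delete_verts)
    qed
    have xV: "x \<in> verts G" using adjV x by blast
    have uV: "u \<in> verts G" using qu w by (auto simp: graph_cycle_def)
    obtain a b where ab: "w = a @ u # b" using qu by (meson split_list)
    define r where "r = b @ a"
    have w': "graph_cycle G (u # r)" using graph_cycle_rotate[of G a u b] w ab unfolding r_def by simp
    have len: "length (u # r) = length w" and setw: "set w = insert u (set r)"
      using ab unfolding r_def by auto
    have ur: "u \<notin> set r" using w' by (simp add: graph_cycle_def)
    obtain z where z: "z \<in> set r"
      using w' by (cases r) (auto simp: graph_cycle_def)
    have zV: "z \<in> verts G - {u}" using z w' ur by (auto simp: graph_cycle_def)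
    have xu: "x \<in> verts G - {u}" using x xV qu by auto
  have r2: "(x, z) \<in> (adjacency (delete_verts G {u}))\<^sup>*" "x \<notin> set r" "z \<in> set r"
    using reach[of "{u}" x z] uV xu zV z x setw by simp_all
  obtain p v where p: "p \<noteq> []" "hd p = x" "distinct p"
    "successively (\<lambda>x y. (x, y) \<in> adjacency (delete_verts G {u})) p"
    "set p \<inter> set r = {}" "set p \<subseteq> insert x (Range (adjacency (delete_verts G {u})))"
    "(last p, v) \<in> adjacency (delete_verts G {u})" "v \<in> set r"
    by (rule rtrancl_first_hit[OF r2])
    have pw: "walk G p"
      using p(4) by (rule successively_mono) (auto simp: adjacency_delete_verts)
    have pV: "set p \<subseteq> verts G" "u \<notin> set p"
    proof -
      have "Range (adjacency (delete_verts G {u})) \<subseteq> verts G - {u}"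
        using adjV(2) by (auto simp: adjacency_delete_verts)
      then have "insert x (Range (adjacency (delete_verts G {u}))) \<subseteq> verts G - {u}"
        using xu by simp
      from order_trans[OF p(6) this] show "set p \<subseteq> verts G" "u \<notin> set p" by auto
    qed
    have pv: "(last p, v) \<in> adjacency G" using p(7) by (simp add: adjacency_delete_verts)
    obtain w1 w2 where r: "r = w1 @ v # w2" using p(8) by (meson split_list)
    have W: "distinct (u # w1 @ v # w2)" "set (u # w1 @ v # w2) \<subseteq> verts G"
      "walk G (u # w1 @ v # w2)" "(last (v # w2), u) \<in> adjacency G"
      using w' unfolding r graph_cycle_def by auto
    have pd: "set p \<inter> set (u # w1 @ v # w2) = {}" using p(5) pV(2) r by auto
    consider "w1 = []" | "w2 = []" | "w1 \<noteq> []" "w2 \<noteq> []" by blast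
    then show False
    proof cases
      case 1
      have "graph_cycle G (u # p @ v # w2)"
        unfolding graph_cycle_def using 1 W p pw pv pV pd adjacency_sym[OF x(2)]
        by (auto simp: successively_append_iff successively_Cons)
      from max[OF this] show False using len p(1) by (cases p) (simp_all add: r 1)
    next
      case 2
      have "walk G (rev p)"
        unfolding successively_rev using pw by (rule successively_mono) (auto intro: adjacency_sym)
      then have "graph_cycle G (u # w1 @ v # rev p)"
        unfolding graph_cycle_def using 2 W p pw pv pV pd adjacency_sym[OF pv] x(2)
        by (auto simp: successively_append_iff successively_Cons last_rev hd_rev hd_append)
      from max[OF this] show False using len p(1) by (cases p) (simp_all add: r 2)
    next
      case 3
      define L where "L = (\<lambda>i::nat. if i = 0 then set w1 else if i = 1 then set w2 else set p)"
      have ww: "walk G w1" "walk G w2" "(u, hd w1) \<in> adjacency G" "(last w1, v) \<in> adjacency G"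
        "(v, hd w2) \<in> adjacency G" "(last w2, u) \<in> adjacency G"
        using W 3 by (auto simp: successively_append_iff successively_Cons)
      have adjE: "\<exists>e\<in>edges G. ends G e = {x, y}" if "(x, y) \<in> adjacency G" for x y
        using that by (auto simp: adjacency_def)
      show False
      proof (rule no_K23_minor[OF O, of "{u}" "{v}" L])
        fix i :: nat assume i: "i < 3"
        show "L i \<subseteq> verts G" "{u} \<inter> L i = {}" "{v} \<inter> L i = {}"
          using W pV pd unfolding L_def by auto
        show "L i \<inter> L j = {}" if "j < 3" "i \<noteq> j" for j
          using that i W pd unfolding L_def less3_cases by auto
        show "(x, y) \<in> (adjacency G \<inter> L i \<times> L i)\<^sup>*" if "x \<in> L i" "y \<in> L i" for x y
          using that walk_connected pw ww unfolding L_def by (auto split: if_splits)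
        have "\<exists>l\<in>L i. (u, l) \<in> adjacency G"
          using i ww(3) adjacency_sym[OF ww(6)] adjacency_sym[OF x(2)] p(1,2) 3
          unfolding less3_cases L_def by (auto intro: last_in_set hd_in_set)
        then show "\<exists>e\<in>edges G. \<exists>a\<in>{u}. \<exists>l\<in>L i. ends G e = {a, l}" using adjE by blast
        have "\<exists>l\<in>L i. (v, l) \<in> adjacency G"
          using i ww(5) adjacency_sym[OF ww(4)] adjacency_sym[OF pv] p(1,2) 3
          unfolding less3_cases L_def by (auto intro: last_in_set hd_in_set)
        then show "\<exists>e\<in>edges G. \<exists>a\<in>{v}. \<exists>l\<in>L i. ends G e = {a, l}" using adjE by blast
      qed (use W uV in auto)
    qed
  qed
  then show ?thesis using that w by blast
qed

lemma arc_set_truncate: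
  assumes "arc_set K a b" "closed C" "a \<notin> C"
  obtains T a' where "arc_set T a' b" "T \<subseteq> K - {a}" "K \<inter> C \<subseteq> T"
proof -
  obtain g where g: "arc g" "pathstart g = a" "pathfinish g = b" "path_image g = K"
    using assms arc_set_def by auto
  have gc: "continuous_on {0..1} g" and ginj: "inj_on g {0..1}" and g01: "g 0 = a" "g 1 = b"
    using g by (auto simp: arc_def path_def pathstart_def pathfinish_def)
  obtain d where d: "d > 0" "ball a d \<inter> C = {}"
    using assms(2,3) by (metis ComplI disjoint_eq_subset_Compl open_Compl openE)
  have "\<exists>e>0. \<forall>t\<in>{0..1}. dist t 0 < e \<longrightarrow> dist (g t) (g 0) < d"
    using gc d(1) unfolding continuous_on_iff by (metis atLeastAtMost_iff order_refl zero_le_one)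
  then obtain e where e: "e > 0" "\<And>t. t \<in> {0..1} \<Longrightarrow> dist t 0 < e \<Longrightarrow> dist (g t) (g 0) < d"
    by blast
  define t where "t = min (1 / 2) (e / 2)"
  have t: "0 < t" "t < 1" "t < e" using e(1) unfolding t_def by auto
  show ?thesis
  proof
    show "arc_set (g ` {t..1}) (g t) b"
      unfolding arc_set_def using g g01 t
      by (intro exI[of _ "subpath t 1 g"]) (auto intro: arc_subpath_arc simp: path_image_subpath)
    show "g ` {t..1} \<subseteq> K - {a}"
      using g(4) t ginj unfolding path_image_def g01(1)[symmetric] by (auto dest!: inj_onD)
    show "K \<inter> C \<subseteq> g ` {t..1}"
    proof
      fix x assume x: "x \<in> K \<inter> C"
      then obtain r where r: "r \<in> {0..1}" "x = g r" using g(4) by (auto simp: path_image_def)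
      have "\<not> r < t"
      proof
        assume "r < t"
        then have "x \<in> ball a d" using e(2)[of r] r t g01 by (simp add: dist_commute)
        then show False using d x by blast
      qed
      then show "x \<in> g ` {t..1}" using r by simp
    qed
  qed
qed

section \<open>Hamiltonian cycles in plane drawings\<close>

context plane_graph
begin

lemma compact_subskel:
  assumes "VS \<subseteq> verts G" "ES \<subseteq> edges G"
  shows "compact (subskel D VS ES)"
proof -
  have "finite VS" "finite ES"
    using assms finite_multigraph unfolding finite_multigraph_def by (auto intro: finite_subset)
  moreover have "compact (im e)" if "e \<in> ES" for e
    using that assms(2) path_im by (blast intro: compact_path_image)
  ultimately show ?thesis
    unfolding subskel_def by (intro compact_Un compact_UN) (auto intro: finite_imp_compact)
qed

lemma skeleton_eq: "skeleton G D = subskel D (verts G) (edges G)"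
  by (simp add: skeleton_def subskel_def)

lemma face_facts:
  assumes "F \<in> drawing_faces G D"
  shows "open F" "connected F" "F \<noteq> {}" "F \<inter> skeleton G D = {}" "frontier F \<subseteq> skeleton G D"
proof -
  have cl: "closed (skeleton G D)"
    unfolding skeleton_eq using compact_subskel compact_imp_closed by blast
  have F: "F \<in> components (- skeleton G D)" using assms by (simp add: drawing_faces_def)
  show "open F" using F cl by (meson open_Compl open_components)
  show "connected F" "F \<noteq> {}" "F \<inter> skeleton G D = {}"
    using F in_components_connected in_components_nonempty in_components_subset by blast+
  show "frontier F \<subseteq> skeleton G D" using frontier_of_components_closed_complement[OF cl F] .
qed

end

text \<open>The Hamiltonian cycle is a periodic sequence on all natural numbers, so an arc that
  wraps around is still an index interval. The drawing is arbitrary here: the locale serves both the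
  outerplanar drawing and the given one.\<close>

locale plane_ham = plane_graph G D
  for G :: "('v, 'e) multigraph" and D :: "('v, 'e) drawing" +
  fixes c :: "nat \<Rightarrow> 'v" and n :: nat and ed :: "nat \<Rightarrow> 'e"
  assumes simple: "simple_graph G" and n3: "3 \<le> n"
    and per: "c (i + n) = c i" and inj: "inj_on c {..<n}" and onto: "c ` {..<n} = verts G"
    and ed: "ed i \<in> edges G" "ends G (ed i) = {c i, c (Suc i)}"
begin

lemma edge_eqI: "e \<in> edges G \<Longrightarrow> f \<in> edges G \<Longrightarrow> ends G e = ends G f \<Longrightarrow> e = f"
  using simple unfolding simple_graph_def by (meson inj_onD)

lemma c_mod: "c i = c (i mod n)"
proof -
  have "c (j + k * n) = c j" for j k
    by (induction k) (auto simp: per add.assoc[symmetric] add.commute[of n] simp flip: add.assoc)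
  from this[of "i mod n" "i div n"] show ?thesis by simp
qed

lemma c_eq: "c i = c j \<longleftrightarrow> i mod n = j mod n"
proof -
  have "c i = c j \<longleftrightarrow> c (i mod n) = c (j mod n)" using c_mod by metis
  also have "\<dots> \<longleftrightarrow> i mod n = j mod n" using n3 inj by (intro inj_on_eq_iff[OF inj]) auto
  finally show ?thesis .
qed

text \<open>A nonzero multiple of \<open>n\<close> cannot be a difference smaller than
  \<open>n\<close>. Below, this replaces congruences by comparisons of indices.\<close>

lemma c_window: "c i = c j \<longleftrightarrow> i = j" if "i < j + n" "j < i + n"
proof -
  have *: "i = j" if "i \<le> j" "j < i + n" "i mod n = j mod n" for i j
  proof -
    have "n dvd j - i" using that by (metis mod_eq_dvd_iff_nat)
    then show ?thesis using that nat_dvd_not_less[of "j - i" n] by (cases "i = j") auto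
  qed
  show ?thesis
    using *[of i j] *[of j i] that unfolding c_eq by (cases "i \<le> j") auto
qed

lemma c_verts [simp]: "c i \<in> verts G"
  using onto c_mod[of i] n3 by auto

lemma verts_window: "c ` {a..<a + n} = verts G"
proof (rule card_subset_eq)
  show "finite (verts G)" using finite_multigraph by (simp add: finite_multigraph_def)
  have "inj_on c {a..<a + n}" by (auto simp: inj_on_def c_window)
  then show "card (c ` {a..<a + n}) = card (verts G)"
    using card_image[OF inj] onto by (simp add: card_image)
qed auto

lemma ed_mod: "i mod n = j mod n \<Longrightarrow> ed i = ed j"
  using c_eq[of i j] c_eq[of "Suc i" "Suc j"] mod_Suc_eq[of i n] mod_Suc_eq[of j n] ed
  by (intro edge_eqI) simp_all

lemma range_ed: "range ed = ed ` {a..<a + n}"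
proof -
  have "ed i \<in> ed ` {a..<a + n}" for i
  proof -
    have "c i \<in> c ` {a..<a + n}" using verts_window by simp
    then obtain j where j: "j \<in> {a..<a + n}" "c i = c j" by blast
    then show ?thesis using ed_mod[of i j] c_eq by auto
  qed
  then show ?thesis by blast
qed

text \<open>Indices may exceed \<open>n\<close>: the complement of \<open>arcC a b\<close> in the
  cycle is written \<open>arcC b (a + n)\<close>.\<close>

definition arcC :: "nat \<Rightarrow> nat \<Rightarrow> complex set" where
  "arcC a b = (\<Union>t\<in>{a..<b}. im (ed t))"

definition cyc :: "complex set" where
  "cyc = (\<Union>t. im (ed t))"

lemma ends_ed_image: "a < b \<Longrightarrow> (\<Union>t\<in>{a..<b}. ends G (ed t)) = c ` {a..b}"
proof -
  assume "a < b"
  have "i \<in> {a..b} \<Longrightarrow> \<exists>t\<in>{a..<b}. i = t \<or> i = Suc t" for i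
    using \<open>a < b\<close> by (cases "i < b") (auto intro: bexI[of _ i] bexI[of _ "b - 1"])
  then show ?thesis by (fastforce simp: ed(2))
qed

lemma arcC_subskel: "a < b \<Longrightarrow> arcC a b = subskel D (c ` {a..b}) (ed ` {a..<b})"
proof -
  assume "a < b"
  have "pt v \<in> arcC a b" if "v \<in> c ` {a..b}" for v
  proof -
    have "v \<in> (\<Union>t\<in>{a..<b}. ends G (ed t))" unfolding ends_ed_image[OF \<open>a < b\<close>] by (fact that)
    then obtain t where "t \<in> {a..<b}" "v \<in> ends G (ed t)" by blast
    then show ?thesis unfolding arcC_def using pt_in_im[OF ed(1)] ends_verts[OF ed(1)] by blast
  qed
  then show ?thesis unfolding subskel_def arcC_def by auto
qed

lemma c_image_verts: "c ` S \<subseteq> verts G"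
  by auto

lemma ed_image_edges: "ed ` S \<subseteq> edges G"
  using ed by auto

lemma pt_in_arcC: "a < b \<Longrightarrow> v \<in> verts G \<Longrightarrow> pt v \<in> arcC a b \<longleftrightarrow> v \<in> c ` {a..b}"
  by (simp add: arcC_subskel pt_in_subskel[OF c_image_verts ed_image_edges] ends_ed_image)

lemma arcC_Int_im:
  assumes "a < b" "e \<in> edges G" "e \<notin> ed ` {a..<b}"
  shows "arcC a b \<inter> im e = pt ` (c ` {a..b} \<inter> ends G e)"
proof -
  have "im e = subskel D {} {e}" by (simp add: subskel_def)
  then show ?thesis
    using subskel_Int[OF c_image_verts[of "{a..b}"] ed_image_edges[of "{a..<b}"], of "{}" "{e}"] assms
    by (simp add: arcC_subskel ends_ed_image)
qed

lemma im_Int_im: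
  assumes "e \<in> edges G" "f \<in> edges G" "e \<noteq> f"
  shows "im e \<inter> im f = pt ` (ends G e \<inter> ends G f)"
  using subskel_Int[of "{}" "{e}" "{}" "{f}"] assms by (simp add: subskel_def)

lemma ed_notin: "b \<le> j \<Longrightarrow> j < a + n \<Longrightarrow> ed j \<notin> ed ` {a..<b}"
proof
  assume j: "b \<le> j" "j < a + n" "ed j \<in> ed ` {a..<b}"
  then obtain i where i: "a \<le> i" "i < b" "ed j = ed i" by auto
  then have eq: "{c i, c (Suc i)} = {c j, c (Suc j)}" using ed(2) by metis
  have "c i \<noteq> c j" using i j by (subst c_window) auto
  then have "c (Suc i) = c j" "c (Suc j) = c i" using eq by (auto simp: doubleton_eq_iff)
  \<comment> \<open>Coinciding edges would be traversed in opposite directions, which happens only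
    on a cycle of length two.\<close>
  then have "Suc i = j" "c (i + 2) = c i" using i j by (auto simp: c_window)
  then show False using n3 c_window[of "i + 2" i] by simp
qed

lemma arcC_Suc: "a \<le> b \<Longrightarrow> arcC a (Suc b) = arcC a b \<union> im (ed b)"
  unfolding arcC_def by (auto simp: less_Suc_eq)

lemma arcC_arc_set:
  assumes "a < b" "b < a + n"
  shows "arc_set (arcC a b) (pt (c a)) (pt (c b))"
  using assms
proof (induction b)
  case (Suc b)
  have edge: "arc_set (im (ed b)) (pt (c b)) (pt (c (Suc b)))"
    using ed n3 by (intro edge_arc_set) (auto simp: c_window)
  show ?case
  proof (cases "a = b")
    case True
    then show ?thesis using edge by (simp add: arcC_def)
  next
    case False
    then have ab: "a < b" using Suc by simp
    have "c ` {a..b} \<inter> {c b, c (Suc b)} = {c b}"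
      using ab Suc.prems by (auto simp: c_window)
    moreover have "arcC a b \<inter> im (ed b) = pt ` (c ` {a..b} \<inter> {c b, c (Suc b)})"
      using arcC_Int_im[OF ab ed(1)[of b] ed_notin[of b b a]] Suc.prems unfolding ed(2) by simp
    ultimately have "arcC a b \<inter> im (ed b) = {pt (c b)}" by (metis image_empty image_insert)
    then show ?thesis
      using arc_set_join[OF _ edge] Suc ab by (simp add: arcC_Suc)
  qed
qed simp

lemma arcC_Un: "a \<le> b \<Longrightarrow> b \<le> d \<Longrightarrow> arcC a b \<union> arcC b d = arcC a d"
  unfolding arcC_def by (simp flip: UN_Un add: ivl_disj_un_two)

lemma arcC_full: "arcC a (a + n) = cyc"
proof -
  have "cyc = (\<Union>e\<in>range ed. im e)" by (simp add: cyc_def)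
  also have "\<dots> = arcC a (a + n)" unfolding range_ed[of a] arcC_def by simp
  finally show ?thesis by simp
qed

lemma arcC_complement:
  assumes "a < b" "b < a + n"
  shows "arcC a b \<inter> arcC b (a + n) = {pt (c a), pt (c b)}" "arcC a b \<union> arcC b (a + n) = cyc"
    "arc_set (arcC b (a + n)) (pt (c a)) (pt (c b))"
    "c ` {a..b} \<inter> c ` {b..a + n} = {c a, c b}" "c ` {a..b} \<union> c ` {b..a + n} = verts G"
proof -
  show I: "c ` {a..b} \<inter> c ` {b..a + n} = {c a, c b}"
  proof
    show "c ` {a..b} \<inter> c ` {b..a + n} \<subseteq> {c a, c b}"
    proof
      fix v assume "v \<in> c ` {a..b} \<inter> c ` {b..a + n}"
      then obtain i j where ij: "v = c i" "c i = c j" "a \<le> i" "i \<le> b" "b \<le> j" "j \<le> a + n" by auto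
      then show "v \<in> {c a, c b}"
        using assms per[of a] c_window[of i j] by (cases "j = a + n") auto
    qed
    show "{c a, c b} \<subseteq> c ` {a..b} \<inter> c ` {b..a + n}"
      using assms per[of a] by (auto intro: rev_image_eqI[of "a + n"])
  qed
  have "ed ` {a..<b} \<inter> ed ` {b..<a + n} = {}"
  proof (rule equals0I, elim IntE)
    fix e assume "e \<in> ed ` {a..<b}" "e \<in> ed ` {b..<a + n}"
    then obtain j where "j \<in> {b..<a + n}" "ed j \<in> ed ` {a..<b}" by (metis imageE)
    then show False using ed_notin[of b j a] by simp
  qed
  then show "arcC a b \<inter> arcC b (a + n) = {pt (c a), pt (c b)}"
    using assms I subskel_Int[OF c_image_verts[of "{a..b}"] ed_image_edges[of "{a..<b}"]
       c_image_verts[of "{b..a + n}"] ed_image_edges[of "{b..<a + n}"]]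
    by (simp add: arcC_subskel ends_ed_image)
  show "arcC a b \<union> arcC b (a + n) = cyc" using assms by (simp add: arcC_Un arcC_full)
  show "arc_set (arcC b (a + n)) (pt (c a)) (pt (c b))"
    using arcC_arc_set[of b "a + n"] assms per[of a] by (auto intro: arc_set_sym)
  have "{a..<a + n} \<subseteq> {a..b} \<union> {b..a + n}" using assms by auto
  then show "c ` {a..b} \<union> c ` {b..a + n} = verts G"
    using verts_window[of a] c_image_verts image_mono[of "{a..<a + n}" "{a..b} \<union> {b..a + n}" c]
    by (simp add: image_Un subset_antisym)
qed

section \<open>Chords of the Hamiltonian cycle and their crossings\<close>

definition chord :: "'e \<Rightarrow> bool" where
  "chord e \<longleftrightarrow> e \<in> edges G \<and> e \<notin> range ed"

lemma edge_ends_window: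
  assumes "e \<in> edges G"
  obtains i j where "ends G e = {c i, c j}" "a \<le> i" "i < j" "j < a + n"
proof -
  have "card (ends G e) = 2" using simple assms unfolding simple_graph_def by blast
  then obtain u v where uv: "ends G e = {u, v}" "u \<noteq> v" by (meson card_2_iff)
  then have "u \<in> verts G" "v \<in> verts G" using ends_verts[OF assms] by auto
  then obtain i j where ij: "u = c i" "v = c j" "i \<in> {a..<a + n}" "j \<in> {a..<a + n}"
    using verts_window[of a] by (metis imageE)
  then show ?thesis
    using that[of i j] that[of j i] uv by (cases "i < j") (auto simp: insert_commute not_less le_less)
qed

text \<open>Together with \<open>arcC_arc_set\<close> and \<open>arcC_complement\<close> this says
  that a chord and the two arcs between its ends form a theta curve.\<close>

lemma chord_theta:
  assumes "chord e" "ends G e = {c i, c j}" "i < j" "j < i + n"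
  shows "arc_set (im e) (pt (c i)) (pt (c j))"
    "arcC i j \<inter> im e = {pt (c i), pt (c j)}" "arcC j (i + n) \<inter> im e = {pt (c i), pt (c j)}"
proof -
  show "arc_set (im e) (pt (c i)) (pt (c j))"
    using assms by (intro edge_arc_set) (auto simp: chord_def c_window)
  have e: "e \<in> edges G" "e \<notin> ed ` S" for S using assms by (auto simp: chord_def)
  have "{c i, c j} \<subseteq> c ` {i..j}" "{c i, c j} \<subseteq> c ` {j..i + n}"
    using assms arcC_complement(4)[of i j] by blast+
  then show "arcC i j \<inter> im e = {pt (c i), pt (c j)}" "arcC j (i + n) \<inter> im e = {pt (c i), pt (c j)}"
    using arcC_Int_im[OF _ e] assms by (simp_all add: Int_absorb1)
qed

text \<open>The ends of \<open>f\<close> lie inside the two arcs cut off by \<open>e\<close> and are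
  on the face \<open>Of\<close>, so by \<open>theta_side\<close> the chord \<open>e\<close> is drawn
  on the side of the cycle away from \<open>Of\<close>. By symmetry so is \<open>f\<close>. But
  \<open>f\<close> itself joins these two arcs, so it separates from \<open>e\<close> in the same
  way.\<close>

lemma no_crossing_chords:
  assumes O: "Of \<in> drawing_faces G D" "\<And>v. v \<in> verts G \<Longrightarrow> pt v \<in> frontier Of"
    and e: "chord e" "ends G e = {c i, c j}" and f: "chord f" "ends G f = {c k, c l}"
    and lt: "i < k" "k < j" "j < l" "l < i + n"
  shows False
proof -
  have ij: "i < j" "j < i + n" and kl: "k < l" "l < k + n" using lt by auto
  note te = arcC_arc_set[OF ij] arcC_complement[OF ij] chord_theta[OF e ij]
  note tf = arcC_arc_set[OF kl] arcC_complement[OF kl] chord_theta[OF f kl]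
  have neq: "c k \<noteq> c i" "c k \<noteq> c j" "c l \<noteq> c i" "c l \<noteq> c j" "c i \<noteq> c j" "c k \<noteq> c l"
    using lt by (auto simp: c_window)
  have in_e: "pt (c k) \<in> arcC i j - {pt (c i), pt (c j)}" "pt (c l) \<in> arcC j (i + n) - {pt (c i), pt (c j)}"
    using lt neq by (auto simp: pt_in_arcC pt_eq)
  have "c (i + n) \<in> c ` {l..k + n}" using lt by (intro imageI) auto
  then have in_f: "pt (c j) \<in> arcC k l - {pt (c k), pt (c l)}" "pt (c i) \<in> arcC l (k + n) - {pt (c k), pt (c l)}"
    using lt neq by (auto simp: pt_in_arcC pt_eq per)
  have ef: "e \<in> edges G" "f \<in> edges G" "e \<noteq> f"
    using e f neq by (auto simp: chord_def doubleton_eq_iff)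
  have "im f \<inter> im e = {}" using im_Int_im[of f e] ef e f neq by auto
  have ce: "cyc \<inter> im e = {pt (c i), pt (c j)}"
    unfolding te(3)[symmetric] Int_Un_distrib2 te(8,9) by simp
  have cf: "cyc \<inter> im f = {pt (c k), pt (c l)}"
    unfolding tf(3)[symmetric] Int_Un_distrib2 tf(8,9) by simp
  have sk: "cyc \<union> im e \<union> im f \<subseteq> skeleton G D"
    using ef ed unfolding cyc_def skeleton_def by auto
  note Of = face_facts[OF O(1)]
  have clO: "pt (c t) \<in> closure Of" for t using O(2)[of "c t"] by (simp add: frontier_def)
  obtain x where x: "x \<in> Of" using Of(3) by blast
  obtain y where y: "y \<in> im e - {pt (c i), pt (c j)}" using arc_set_interior(2)[OF te(7)] by blast
  obtain z where z: "z \<in> im f - {pt (c k), pt (c l)}" using arc_set_interior(2)[OF tf(7)] by blast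
  have 1: "\<not> connected_component (- cyc) x y"
  proof -
    have "Of \<inter> (arcC i j \<union> arcC j (i + n) \<union> im e) = {}" unfolding te(3) using Of(4) sk by blast
    moreover have "closure Of \<inter> (arcC i j - {pt (c i), pt (c j)}) \<noteq> {}"
      using in_e(1) clO[of k] by blast
    moreover have "closure Of \<inter> (arcC j (i + n) - {pt (c i), pt (c j)}) \<noteq> {}"
      using in_e(2) clO[of l] by blast
    ultimately show ?thesis using theta_side[OF te(1,4,7,2,8,9) Of(2) _ _ _ x y] te(3) by simp
  qed
  have 2: "\<not> connected_component (- cyc) x z"
  proof -
    have "Of \<inter> (arcC k l \<union> arcC l (k + n) \<union> im f) = {}" unfolding tf(3) using Of(4) sk by blast
    moreover have "closure Of \<inter> (arcC k l - {pt (c k), pt (c l)}) \<noteq> {}"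
      using in_f(1) clO[of j] by blast
    moreover have "closure Of \<inter> (arcC l (k + n) - {pt (c k), pt (c l)}) \<noteq> {}"
      using in_f(2) clO[of i] by blast
    ultimately show ?thesis using theta_side[OF tf(1,4,7,2,8,9) Of(2) _ _ _ x z] tf(3) by simp
  qed
  \<comment> \<open>The interior of \<open>f\<close> now takes the role that \<open>Of\<close> had
    before: its closure contains the ends of \<open>f\<close>, one inside either arc of
    \<open>e\<close>.\<close>
  have "\<not> connected_component (- (arcC i j \<union> arcC j (i + n))) z y"
  proof (rule theta_side[OF te(1,4,7,2,8,9) arc_set_interior(1)[OF tf(7)] _ _ _ z y])
    show "(im f - {pt (c k), pt (c l)}) \<inter> (arcC i j \<union> arcC j (i + n) \<union> im e) = {}"
      unfolding te(3) using equalityD1[OF cf] \<open>im f \<inter> im e = {}\<close> by blast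
    have "pt (c k) \<in> closure (im f - {pt (c k), pt (c l)})" "pt (c l) \<in> closure (im f - {pt (c k), pt (c l)})"
      using arc_set_interior(3)[OF tf(7)] arc_set_ends[OF tf(7)] by blast+
    then show "closure (im f - {pt (c k), pt (c l)}) \<inter> (arcC i j - {pt (c i), pt (c j)}) \<noteq> {}"
      "closure (im f - {pt (c k), pt (c l)}) \<inter> (arcC j (i + n) - {pt (c i), pt (c j)}) \<noteq> {}"
      using in_e by blast+
  qed
  then have 3: "\<not> connected_component (- cyc) z y" unfolding te(3) .
  have xc: "connected {x}" "{x} \<inter> (arcC i j \<union> arcC j (i + n)) = {}" "{x} \<noteq> {}"
    unfolding te(3) using x Of(4) sk by auto
  obtain U N where UN: "open U" "open N" "connected U" "connected N" "N \<noteq> {}" "{x} \<subseteq> U"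
    "U \<inter> N = {}" "U \<union> N = - (arcC i j \<union> arcC j (i + n))"
    "frontier U = arcC i j \<union> arcC j (i + n)" "frontier N = arcC i j \<union> arcC j (i + n)"
    by (rule two_arcs_Jordan[OF te(1,4,2) xc])
  \<comment> \<open>The cycle has only two sides, so three points off it cannot be pairwise
    separated.\<close>
  have "y \<in> U \<union> N" "z \<in> U \<union> N"
    unfolding UN(8) te(3) using y z equalityD1[OF ce] equalityD1[OF cf] by blast+
  moreover have "U \<subseteq> - cyc" "N \<subseteq> - cyc" using UN(8) unfolding te(3) by blast+
  ultimately show False
    using 1 2 3 UN(3,4,6) unfolding connected_component_def by blast
qed

end

section \<open>Vertices and edges on the boundary of a face\<close>

lemma interior_Union_empty:
  assumes "finite \<S>" "\<And>S. S \<in> \<S> \<Longrightarrow> closed S" "\<And>S. S \<in> \<S> \<Longrightarrow> interior S = {}"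
  shows "interior (\<Union>\<S>) = {}"
  using assms by (induction \<S>) (auto simp: interior_closed_Un_empty_interior)

context plane_ham
begin

lemma cyc_Int_chord: "chord e \<Longrightarrow> cyc \<inter> im e = pt ` ends G e"
proof -
  assume e: "chord e"
  then have "e \<in> edges G" by (simp add: chord_def)
  then obtain i j where ij: "ends G e = {c i, c j}" "0 \<le> i" "i < j" "j < 0 + n"
    by (rule edge_ends_window)
  then have w: "i < j" "j < i + n" by auto
  show ?thesis
    unfolding arcC_complement(2)[OF w, symmetric] Int_Un_distrib2 chord_theta(2,3)[OF e ij(1) w] ij(1)
    by simp
qed

lemma cyc_skeleton: "cyc \<subseteq> skeleton G D"
  using ed unfolding cyc_def skeleton_def by auto

lemma arcC_cyc: "arcC a b \<subseteq> cyc"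
  unfolding arcC_def cyc_def by blast

lemma im_skeleton: "e \<in> edges G \<Longrightarrow> im e \<subseteq> skeleton G D"
  unfolding skeleton_def by blast

lemma compact_arcC: "compact (arcC a b)"
  unfolding arcC_def using ed path_im by (intro compact_UN) (auto intro: compact_path_image)

lemma compact_im: "e \<in> edges G \<Longrightarrow> compact (im e)"
  using path_im by (blast intro: compact_path_image)

text \<open>
  If \<^term>\<open>pt (c s)\<close> is not on the boundary of \<open>F\<close>, then \<open>F\<close> is still a component after the edges at
  \<^term>\<open>c s\<close> have been shortened near that vertex. What remains is an arc through all other vertices,
  dangling arcs, and the chords avoiding \<^term>\<open>c s\<close>; by Janiszewski's theorem it separates two points
  only if one of the closed curves formed by a chord and the arc below it does.
\<close>

lemma vertex_on_face_if:
  assumes F: "F \<in> drawing_faces G D" and x: "x \<in> F"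
    and sep: "\<And>e k l. chord e \<Longrightarrow> ends G e = {c k, c l} \<Longrightarrow> s < k \<Longrightarrow> k < l \<Longrightarrow> l < s + n \<Longrightarrow>
      connected_component (- (im e \<union> arcC k l)) x (pt (c s))"
  shows "pt (c s) \<in> frontier F"
proof (rule ccontr)
  assume notin: "pt (c s) \<notin> frontier F"
  note Ff = face_facts[OF F]
  have "pt (c s) \<in> skeleton G D" by (simp add: skeleton_def)
  then have ncl: "pt (c s) \<notin> closure F" using notin Ff(1,4) by (auto simp: frontier_def interior_open)
  have lt: "s + 1 < s + n - 1" "s + n - 1 < s + 1 + n" using n3 by auto
  define K where "K = arcC (s + 1) (s + n - 1)"
  have K: "arc_set K (pt (c (s + 1))) (pt (c (s + n - 1)))"
    unfolding K_def by (rule arcC_arc_set[OF lt])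
  have ptK: "pt v \<in> K \<longleftrightarrow> v \<noteq> c s" if vV: "v \<in> verts G" for v
  proof -
    obtain i where i: "v = c i" "i \<in> {s..<s + n}" using vV verts_window[of s] by blast
    then have "v = c s \<longleftrightarrow> i = s" by (simp add: c_window)
    moreover have "v \<in> c ` {s + 1..s + n - 1} \<longleftrightarrow> i \<in> {s + 1..s + n - 1}"
      using i by (auto simp: c_window)
    ultimately show ?thesis unfolding K_def pt_in_arcC[OF lt(1) vV] using i(2) by auto
  qed
  define I where "I = edges G - ed ` {s + 1..<s + n - 1}"
  \<comment> \<open>\<open>T\<close> stands in for an edge \<open>e\<close> off \<open>K\<close>. It
    keeps all points of \<open>e\<close> that can lie on the frontier of \<open>F\<close>, gives up
    \<open>pt (c s)\<close>, and satisfies the two conditions of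
    \<open>Janiszewski_family\<close>.\<close>
  define Q where "Q e T \<longleftrightarrow> compact T \<and> im e \<inter> closure F \<subseteq> T \<and> pt (c s) \<notin> T \<and> T \<subseteq> K \<union> im e \<and>
    connected (K \<inter> T) \<and> connected_component (- T) x (pt (c s))" for e T
  have KI: "K \<inter> im e = pt ` (c ` {s + 1..s + n - 1} \<inter> ends G e)" if "e \<in> I" for e
    unfolding K_def using that arcC_Int_im[OF lt(1)] by (auto simp: I_def)
  have "\<exists>T. Q e T" if e: "e \<in> I" for e
  proof (cases "c s \<in> ends G e")
    case True
    have eE: "e \<in> edges G" using e by (simp add: I_def)
    have "card (ends G e) = 2" using simple eE unfolding simple_graph_def by blast
    then obtain y z where yz: "ends G e = {y, z}" "y \<noteq> z" by (meson card_2_iff)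
    obtain u where u: "ends G e = {c s, u}" "c s \<noteq> u"
      using that[of z] that[of y] yz True by (cases "c s = y") (auto simp: insert_commute)
    have uV: "u \<in> verts G" using u ends_verts[OF eE] by auto
    obtain T a' where T: "arc_set T a' (pt u)" "T \<subseteq> im e - {pt (c s)}" "im e \<inter> closure F \<subseteq> T"
      by (rule arc_set_truncate[OF edge_arc_set[OF eE u] closed_closure ncl])
    have "K \<inter> im e \<subseteq> {pt u}"
    proof
      fix z assume z: "z \<in> K \<inter> im e"
      then obtain v where v: "z = pt v" "v \<in> ends G e" using KI[OF e] by auto
      then have "v \<noteq> c s" using ptK[of v] z ends_verts[OF eE] by auto
      then show "z \<in> {pt u}" using v u by auto
    qed
    then have "K \<inter> T = {pt u}" using T(2) arc_set_ends[OF T(1)] ptK[OF uV] u(2) by blast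
    moreover have "x \<in> - T" "pt (c s) \<in> - T"
      using x T(2) im_skeleton[OF eE] Ff(4) by blast+
    then have "connected_component (- T) x (pt (c s))"
      using arc_set_connected_Compl[OF T(1)] unfolding connected_component_def by blast
    ultimately show ?thesis
      unfolding Q_def using T arc_set_compact[OF T(1)] by (intro exI[of _ T]) auto
  next
    case False
    have eE: "e \<in> edges G" using e by (simp add: I_def)
    have ch: "chord e"
    proof -
      have "e \<noteq> ed t" if "t \<in> {s..<s + n}" for t
      proof -
        have "t \<in> {s + 1..<s + n - 1} \<or> t = s \<or> t = s + n - 1" using that by auto
        moreover have "e \<noteq> ed s" using False ed(2)[of s] by auto
        moreover have "c (Suc (s + n - 1)) = c s" using per[of s] n3 by simp
        then have "e \<noteq> ed (s + n - 1)" using False ed(2)[of "s + n - 1"] by auto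
        ultimately show ?thesis using e unfolding I_def by blast
      qed
      then have "e \<notin> range ed" unfolding range_ed[of s] by blast
      then show ?thesis using eE by (simp add: chord_def)
    qed
    obtain k l where kl: "ends G e = {c k, c l}" "s \<le> k" "k < l" "l < s + n"
      using edge_ends_window[OF eE] by metis
    then have sk: "s < k" using False by (cases "k = s") auto
    let ?T = "im e \<union> arcC k l"
    have cc: "connected_component (- ?T) x (pt (c s))" using sep[OF ch kl(1) sk kl(3,4)] .
    have sub: "arcC k l \<subseteq> K" unfolding K_def arcC_def using sk kl by (intro UN_mono) auto
    have "K \<inter> im e \<subseteq> arcC k l"
      using KI[OF e] kl(1,3) by (auto simp: pt_in_arcC)
    then have "K \<inter> ?T = arcC k l" using sub by blast
    moreover have "connected (arcC k l)"
      using arc_set_connected[OF arcC_arc_set[of k l]] kl by simp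
    moreover have "pt (c s) \<notin> ?T"
      using connected_component_in[OF cc] by blast
    ultimately show ?thesis
      unfolding Q_def using sub cc compact_im[OF eE] compact_arcC
      by (intro exI[of _ ?T]) (auto intro: compact_Un)
  qed
  then obtain T where T: "\<And>e. e \<in> I \<Longrightarrow> Q e (T e)" by metis
  have "connected_component (- (K \<union> \<Union>(T ` I))) x (pt (c s))"
  proof (rule Janiszewski_family)
    show "finite I" using finite_multigraph by (simp add: I_def finite_multigraph_def)
    show "compact K" using arc_set_compact[OF K] .
    show "compact (T e)" "connected_component (- T e) x (pt (c s))" if "e \<in> I" for e
      using T[OF that] by (auto simp: Q_def)
    have "x \<in> - K" "pt (c s) \<in> - K"
    proof -
      have "K \<subseteq> skeleton G D" unfolding K_def using arcC_cyc cyc_skeleton by (rule order_trans)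
      then show "x \<in> - K" using x Ff(4) by blast
      show "pt (c s) \<in> - K" using ptK[of "c s"] by simp
    qed
    then show "connected_component (- K) x (pt (c s))"
      unfolding connected_component_def using arc_set_connected_Compl[OF K]
      by (intro exI[of _ "- K"]) auto
    show "connected ((K \<union> \<Union>(T ` J)) \<inter> T e)" if e: "e \<in> I" "J \<subseteq> I - {e}" for e J
    proof -
      \<comment> \<open>Outside \<open>K\<close>, two distinct edges could meet only in the point of
        \<open>c s\<close>, which every \<open>T e\<close> avoids. So only the intersections with
        \<open>K\<close> count.\<close>
      have "T f \<inter> T e \<subseteq> K" if f: "f \<in> J" for f
      proof
        fix z assume z: "z \<in> T f \<inter> T e"
        have fI: "f \<in> I" "f \<noteq> e" using e(2) f by blast+
        show "z \<in> K"
        proof (rule ccontr)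
          assume zK: "z \<notin> K"
          then have "z \<in> im f" "z \<in> im e" using z T[OF fI(1)] T[OF e(1)] unfolding Q_def by blast+
          moreover have "im f \<inter> im e \<subseteq> pt ` verts G"
            using fI e(1) by (intro im_Int) (auto simp: I_def)
          ultimately obtain v where "v \<in> verts G" "z = pt v" by blast
          then have "z = pt (c s)" using ptK[of v] zK by blast
          then show False using z T[OF e(1)] unfolding Q_def by auto
        qed
      qed
      then have "(K \<union> \<Union>(T ` J)) \<inter> T e = K \<inter> T e" by blast
      then show ?thesis using T[OF e(1)] by (simp add: Q_def)
    qed
  qed
  \<comment> \<open>What the shortening removes is not in the closure of \<open>F\<close>, so the
    frontier survives and \<open>connected_component_in_frontier\<close> puts
    \<open>pt (c s)\<close> into \<open>F\<close>.\<close>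
  moreover have "frontier F \<subseteq> K \<union> \<Union>(T ` I)"
  proof
    fix z assume z: "z \<in> frontier F"
    then have zc: "z \<in> closure F" "z \<in> skeleton G D" using Ff(5) by (auto simp: frontier_def)
    then consider v where "v \<in> verts G" "z = pt v" | e where "e \<in> edges G" "z \<in> im e"
      unfolding skeleton_def by blast
    then show "z \<in> K \<union> \<Union>(T ` I)"
    proof cases
      case 1
      then have "v \<noteq> c s" using zc ncl by auto
      then show ?thesis using ptK 1 by simp
    next
      case 2
      show ?thesis
      proof (cases "e \<in> I")
        case True
        then have "z \<in> T e" using T[OF True] zc 2 unfolding Q_def by blast
        then show ?thesis using True by blast
      next
        case False
        then show ?thesis using 2 unfolding I_def K_def arcC_def by blast
      qed
    qed
  qed
  ultimately have "pt (c s) \<in> F" using connected_component_in_frontier x by blast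
  then show False using ncl closure_subset by blast
qed

text \<open>The converse of the criterion in \<open>vertex_on_face_if\<close>: adding a boundary
  point to \<open>F\<close> keeps it connected, and neither \<open>F\<close> nor \<open>pt v\<close>
  meets the closed curve.\<close>

lemma face_on_vertex_side:
  assumes F: "F \<in> drawing_faces G D" and x: "x \<in> F"
    and v: "v \<in> verts G" "pt v \<in> frontier F" "v \<notin> c ` {k..l}"
    and e: "chord e" "ends G e = {c k, c l}" "k < l"
  shows "connected_component (- (im e \<union> arcC k l)) x (pt v)"
proof -
  have "v \<notin> ends G e" using v(3) e(2,3) by auto
  then have "pt v \<notin> im e \<union> arcC k l"
    using e pt_in_arcC[of k l v] pt_in_im[of e v] v(1,3) by (auto simp: chord_def)
  moreover have "F \<inter> (im e \<union> arcC k l) = {}"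
    using face_facts(4)[OF F] arcC_cyc[of k l] cyc_skeleton im_skeleton[of e] e(1) unfolding chord_def by blast
  moreover have "connected (insert (pt v) F)"
  proof (rule connected_intermediate_closure[OF face_facts(2)[OF F]])
    show "insert (pt v) F \<subseteq> closure F"
      using v(2) closure_subset[of F] unfolding frontier_def by blast
  qed blast
  ultimately show ?thesis
    unfolding connected_component_def using x by (intro exI[of _ "insert (pt v) F"]) auto
qed

text \<open>An edge meets the rest of the drawing only in its ends, so
  \<open>arc_set_subset_closure\<close> applies. Touching an edge at one inner point is thus enough
  for being an end of its dual edge.\<close>

lemma edge_subset_frontier:
  assumes F: "F \<in> drawing_faces G D" and e: "e \<in> edges G"
    and p: "p \<in> im e" "p \<notin> pt ` verts G" "p \<in> closure F"
  shows "im e \<subseteq> frontier F"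
proof -
  have "card (ends G e) = 2" using simple e unfolding simple_graph_def by blast
  then obtain u v where uv: "ends G e = {u, v}" "u \<noteq> v" by (meson card_2_iff)
  have uvV: "u \<in> verts G" "v \<in> verts G" using uv ends_verts[OF e] by auto
  let ?S = "subskel D (verts G) (edges G - {e})"
  have im: "im e = subskel D {} {e}" by (simp add: subskel_def)
  have "?S \<inter> im e = pt ` ((verts G \<union> \<Union>(ends G ` (edges G - {e}))) \<inter> ends G e)"
    unfolding im using subskel_Int[of "verts G" "edges G - {e}" "{}" "{e}"] e by simp
  also have "(verts G \<union> \<Union>(ends G ` (edges G - {e}))) \<inter> ends G e = {u, v}" using uv uvV by auto
  finally have Sim: "?S \<inter> im e = {pt u, pt v}" by simp
  have Sk: "?S \<union> im e = skeleton G D" using e unfolding subskel_def skeleton_def by auto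
  have "im e \<subseteq> closure F"
  proof (rule arc_set_subset_closure[OF compact_subskel edge_arc_set[OF e uv] Sim])
    show "F \<inter> (?S \<union> im e) = {}" "frontier F \<subseteq> ?S \<union> im e"
      unfolding Sk using face_facts[OF F] by auto
    show "p \<in> im e - {pt u, pt v}" "p \<in> closure F" using p uvV by auto
  qed auto
  then show ?thesis
    using face_facts(1,4)[OF F] im_skeleton[OF e] by (auto simp: frontier_def interior_open)
qed

text \<open>Finitely many closed sets with empty interior have a union with empty interior.
  Consequently the faces are dense in the plane.\<close>

lemma interior_skeleton: "interior (skeleton G D) = {}"
proof -
  have "skeleton G D = \<Union>((\<lambda>v. {pt v}) ` verts G \<union> im ` edges G)"
    unfolding skeleton_def by auto
  moreover have "interior \<dots> = {}"
  proof (rule interior_Union_empty)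
    show "finite ((\<lambda>v. {pt v}) ` verts G \<union> im ` edges G)"
      using finite_multigraph by (simp add: finite_multigraph_def)
    have "interior (im e) = {}" if e: "e \<in> edges G" for e
    proof -
      have "card (ends G e) = 2" using simple e unfolding simple_graph_def by blast
      then obtain u v where uv: "ends G e = {u, v}" "u \<noteq> v" by (meson card_2_iff)
      show ?thesis using arc_set_empty_interior[OF edge_arc_set[OF e uv]] .
    qed
    then show "interior S = {}" if "S \<in> (\<lambda>v. {pt v}) ` verts G \<union> im ` edges G" for S
      using that by auto
    show "closed S" if "S \<in> (\<lambda>v. {pt v}) ` verts G \<union> im ` edges G" for S
      using that compact_im compact_imp_closed by auto
  qed
  ultimately show ?thesis by simp
qed

end

section \<open>Chords and the dual graph\<close>

text \<open>The assumption yields two facts about the drawing \<open>D\<close>: it has finitely many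
  faces, and each edge lies on the boundary of at most two of them.\<close>

locale plane_ham_dual = plane_ham +
  assumes dual_finite: "finite_multigraph (dual_graph (G, D))"
begin

abbreviation dual where "dual \<equiv> dual_graph (G, D)"

lemma dual_simps: "verts dual = drawing_faces G D" "edges dual = edges G"
  "ends dual e = {F \<in> drawing_faces G D. im e \<subseteq> frontier F}"
  by (simp_all add: dual_graph_def faces_def)

lemma finite_faces: "finite (drawing_faces G D)"
  using dual_finite unfolding finite_multigraph_def dual_simps by blast

lemma faces_disjoint:
  "F \<in> drawing_faces G D \<Longrightarrow> F' \<in> drawing_faces G D \<Longrightarrow> F \<noteq> F' \<Longrightarrow> F \<inter> F' = {}"
  unfolding drawing_faces_def by (meson components_nonoverlap)

lemma dual_ends:
  assumes "e \<in> edges G" "p \<in> im e" "p \<notin> pt ` verts G"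
    "F \<in> drawing_faces G D" "F' \<in> drawing_faces G D" "F \<noteq> F'" "p \<in> closure F" "p \<in> closure F'"
  shows "ends dual e = {F, F'}"
proof -
  have sub: "{F, F'} \<subseteq> ends dual e"
    using edge_subset_frontier assms unfolding dual_simps by blast
  have "card (ends dual e) \<in> {1, 2}"
    using dual_finite assms(1) unfolding finite_multigraph_def dual_simps(2) by blast
  then have "card (ends dual e) \<le> card {F, F'}" using assms(6) by auto
  moreover have "finite (ends dual e)" using finite_faces unfolding dual_simps by simp
  ultimately show ?thesis using card_seteq[OF _ sub] by blast
qed

text \<open>Apart from points of the skeleton, such a region is a union of faces. It represents a
  branch set of the dual, namely \<open>faces_in R\<close>, as a connected part of the
  plane.\<close>

definition face_union :: "complex set \<Rightarrow> bool" where
  "face_union R \<longleftrightarrow> open R \<and> connected R \<and> (\<forall>F\<in>drawing_faces G D. F \<inter> R \<noteq> {} \<longrightarrow> F \<subseteq> R)"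

definition faces_in :: "complex set \<Rightarrow> complex set set" where
  "faces_in R = {F \<in> drawing_faces G D. F \<subseteq> R}"

text \<open>The faces inside \<open>R\<close> are dense in \<open>R\<close>, and as they are
  finitely many, the closure of their union is the union of their closures.\<close>

lemma face_union_cover:
  assumes R: "face_union R" and p: "p \<in> closure R"
  shows "\<exists>F\<in>faces_in R. p \<in> closure F"
proof -
  have "closure (- skeleton G D) = UNIV" using interior_skeleton by (simp add: closure_complement)
  then have "R \<subseteq> closure (R \<inter> - skeleton G D)"
    using open_Int_closure_subset[of R "- skeleton G D"] R by (simp add: face_union_def)
  moreover have "R \<inter> - skeleton G D \<subseteq> \<Union>(faces_in R)"
  proof
    fix x assume x: "x \<in> R \<inter> - skeleton G D"
    then have "x \<in> \<Union>(drawing_faces G D)" unfolding drawing_faces_def Union_components by blast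
    then obtain F where "F \<in> drawing_faces G D" "x \<in> F" by blast
    then show "x \<in> \<Union>(faces_in R)" using R x unfolding face_union_def faces_in_def by blast
  qed
  ultimately have "closure R \<subseteq> closure (\<Union>(faces_in R))"
    by (meson closure_minimal closure_mono closed_closure order_trans)
  also have "\<dots> \<subseteq> \<Union>(closure ` faces_in R)"
  proof (rule closure_minimal)
    show "closed (\<Union>(closure ` faces_in R))" using finite_faces by (auto simp: faces_in_def)
  qed (use closure_subset in blast)
  finally show ?thesis using p by blast
qed

text \<open>
  Deleting the vertex points keeps \<open>R\<close> connected, so two complementary sets of faces touch at an
  interior point of an edge, which is then a dual edge between them.
\<close>

lemma faces_in_connected:
  assumes R: "face_union R" and F: "F \<in> faces_in R" "F' \<in> faces_in R"
  shows "(F, F') \<in> (adjacency dual \<inter> faces_in R \<times> faces_in R)\<^sup>*" (is "_ \<in> ?r\<^sup>*")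
proof (rule ccontr)
  assume neg: "(F, F') \<notin> ?r\<^sup>*"
  define T where "T = {H \<in> faces_in R. (F, H) \<in> ?r\<^sup>*}"
  define T' where "T' = faces_in R - T"
  have FT: "F \<in> T" "F' \<in> T'" using F neg by (auto simp: T_def T'_def)
  have fin: "finite T" "finite T'" using finite_faces by (auto simp: T_def T'_def faces_in_def)
  define A B where "A = \<Union>(closure ` T)" and "B = \<Union>(closure ` T')"
  define R' where "R' = R - pt ` verts G"
  have "connected R'"
    unfolding R'_def using R finite_multigraph unfolding face_union_def finite_multigraph_def
    by (intro connected_open_delete_finite) auto
  moreover have "R' \<subseteq> A \<union> B"
    using face_union_cover[OF R] closure_subset[of R] unfolding A_def B_def R'_def T'_def by blast
  moreover have "closed A" "closed B" unfolding A_def B_def using fin by auto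
  moreover have "A \<inter> R' \<noteq> {}" "B \<inter> R' \<noteq> {}"
  proof -
    have *: "H \<subseteq> R'" "H \<noteq> {}" if "H \<in> faces_in R" for H
      using that face_facts(3,4)[of H] unfolding R'_def faces_in_def skeleton_def by blast+
    have "F \<subseteq> A" "F' \<subseteq> B" unfolding A_def B_def
      using order_trans[OF closure_subset UN_upper[OF FT(1)]] order_trans[OF closure_subset UN_upper[OF FT(2)]]
      by simp_all
    then show "A \<inter> R' \<noteq> {}" "B \<inter> R' \<noteq> {}"
      using *(1)[OF F(1)] *(1)[OF F(2)] *(2)[OF F(1)] *(2)[OF F(2)] by auto
  qed
  ultimately have "A \<inter> B \<inter> R' \<noteq> {}" unfolding connected_closed by meson
  then obtain p H H' where p: "p \<in> R'" "H \<in> T" "H' \<in> T'" "p \<in> closure H" "p \<in> closure H'"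
    unfolding A_def B_def by blast
  have HH: "H \<in> drawing_faces G D" "H' \<in> drawing_faces G D" "H \<noteq> H'" "H \<in> faces_in R" "H' \<in> faces_in R"
    using p(2,3) by (auto simp: T_def T'_def faces_in_def)
  have "p \<notin> H"
    using faces_disjoint[OF HH(1-3)] open_Int_closure_eq_empty[OF face_facts(1)[OF HH(1)], of H'] p(5)
    by blast
  then have "p \<in> frontier H" using p(4) face_facts(1)[OF HH(1)] by (simp add: frontier_def interior_open)
  then have "p \<in> skeleton G D" using face_facts(5)[OF HH(1)] by blast
  then obtain e where e: "e \<in> edges G" "p \<in> im e" "p \<notin> pt ` verts G"
    using p(1) unfolding R'_def skeleton_def by blast
  have "ends dual e = {H, H'}" using dual_ends[OF e HH(1-3) p(4,5)] .
  then have "(H, H') \<in> ?r" using e(1) HH unfolding adjacency_def dual_simps(2)[symmetric] by blast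
  then have "H' \<in> T" using p(2) HH(5) unfolding T_def by (auto intro: rtrancl_into_rtrancl)
  then show False using p(3) by (simp add: T'_def)
qed

text \<open>
  \<open>N i\<close> is the region cut off by the chord \<open>e i\<close> and the arc \<open>X i\<close> of the Hamiltonian cycle. On
  either side of the cycle, what is left outside the three regions \<open>N i\<close> is connected and touches
  each \<open>N i\<close>, through the chord or through the arc. This is a \<open>K\<^sub>2\<^sub>,\<^sub>3\<close> minor of the dual.
\<close>

lemma no_facing_chords:
  fixes e :: "nat \<Rightarrow> 'b" and a b :: "nat \<Rightarrow> nat"
  assumes outer: "outerplanar dual"
    and ch: "\<And>i. i < 3 \<Longrightarrow> chord (e i)" "\<And>i. i < 3 \<Longrightarrow> ends G (e i) = {c (a i), c (b i)}"
    and ab: "\<And>i. i < 3 \<Longrightarrow> a i < b i" "\<And>i. i < 3 \<Longrightarrow> b i < a i + n"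
    and dist: "\<And>i j. i < 3 \<Longrightarrow> j < 3 \<Longrightarrow> i \<noteq> j \<Longrightarrow> e i \<noteq> e j"
    and facing: "\<And>i j. i < 3 \<Longrightarrow> j < 3 \<Longrightarrow> i \<noteq> j \<Longrightarrow> arcC (a j) (b j) \<subseteq> arcC (b i) (a i + n)"
  shows False
proof -
  define X Y E V Z where "X i = arcC (a i) (b i)" and "Y i = arcC (b i) (a i + n)"
    and "E i = im (e i)" and "V i = {pt (c (a i)), pt (c (b i))}" and "Z i = X i \<union> E i" for i
  have eE: "e i \<in> edges G" if "i < 3" for i using ch(1)[OF that] by (simp add: chord_def)
  have arcs: "arc_set (X i) (pt (c (a i))) (pt (c (b i)))" "arc_set (Y i) (pt (c (a i))) (pt (c (b i)))"
    "arc_set (E i) (pt (c (a i))) (pt (c (b i)))" "X i \<inter> Y i = V i" "X i \<union> Y i = cyc"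
    "X i \<inter> E i = V i" "Y i \<inter> E i = V i" "cyc \<inter> E i = V i" if i: "i < 3" for i
    unfolding X_def Y_def E_def V_def
    using arcC_arc_set[OF ab[OF i]] arcC_complement(1-3)[OF ab[OF i]] chord_theta[OF ch[OF i] ab[OF i]]
      cyc_Int_chord[OF ch(1)[OF i]] ch(2)[OF i] by simp_all
  have EV: "E i \<inter> pt ` verts G = V i" if i: "i < 3" for i
    using im_verts[OF eE[OF i]] ch(2)[OF i] by (simp add: E_def V_def)
  have VV: "V i \<subseteq> pt ` verts G" for i by (auto simp: V_def)
  have XY: "X j \<subseteq> Y i" if "i < 3" "j < 3" "i \<noteq> j" for i j
    using facing[OF that] by (simp add: X_def Y_def)
  have EE: "E i \<inter> E j \<subseteq> V i \<inter> V j" if ij: "i < 3" "j < 3" "i \<noteq> j" for i j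
    using im_Int[OF eE[OF ij(1)] eE[OF ij(2)] dist[OF ij]] EV[OF ij(1)] EV[OF ij(2)] unfolding E_def by blast
  have VX: "V i \<subseteq> X i" "V i \<subseteq> E i" "V i \<subseteq> Y i" if "i < 3" for i
    using arcs(4,6)[OF that] by blast+
  \<comment> \<open>\<open>U\<close> and \<open>N\<close> are the two sides of the closed curve
    \<open>Z i\<close>, told apart by the rest of the cycle, which lies in \<open>U\<close>.\<close>
  define P where "P i U N \<longleftrightarrow> open U \<and> open N \<and> connected U \<and> connected N \<and> N \<noteq> {} \<and> Y i - V i \<subseteq> U \<and>
    U \<inter> N = {} \<and> U \<union> N = - Z i \<and> frontier U = Z i \<and> frontier N = Z i" for i U N
  have "\<exists>U N. P i U N" if i: "i < 3" for i
  proof -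
    have "connected (Y i - V i)" "Y i - V i \<noteq> {}"
      using arc_set_interior(1,2)[OF arcs(2)[OF i]] unfolding V_def by blast+
    moreover have "(Y i - V i) \<inter> (X i \<union> E i) = {}"
      using equalityD1[OF arcs(4)[OF i]] equalityD1[OF arcs(7)[OF i]] by blast
    ultimately show ?thesis
      using two_arcs_Jordan[OF arcs(1,3)[OF i] arcs(6)[OF i, unfolded V_def], of "Y i - V i"]
      unfolding Z_def P_def by (metis (no_types, lifting))
  qed
  then obtain U N where PUN: "\<And>i. i < 3 \<Longrightarrow> P i (U i) (N i)" by metis
  have UN: "open (U i)" "open (N i)" "connected (U i)" "connected (N i)" "N i \<noteq> {}"
    "Y i - V i \<subseteq> U i" "U i \<inter> N i = {}" "U i \<union> N i = - Z i" "frontier (U i) = Z i"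
    "frontier (N i) = Z i" if "i < 3" for i
    using PUN[OF that] unfolding P_def by simp_all
  have side: "C \<subseteq> U i" if "i < 3" "connected C" "C \<inter> Z i = {}" "C \<inter> U i \<noteq> {}" for i C
    using connected_subset_side[OF UN(1,2,7)[OF that(1)] that(2)] UN(8)[OF that(1)] that(3,4) by blast
  have sideN: "C \<subseteq> N i" if "i < 3" "connected C" "C \<inter> Z i = {}" "C \<inter> N i \<noteq> {}" for i C
  proof (rule connected_subset_side[OF UN(2,1)[OF that(1)] _ that(2) _ that(4)])
    show "N i \<inter> U i = {}" using UN(7)[OF that(1)] by blast
    show "C \<subseteq> N i \<union> U i" using UN(8)[OF that(1)] that(3) by blast
  qed
  have cycN: "cyc \<inter> N i = {}" if i: "i < 3" for i
  proof -
    have "X i \<inter> N i = {}" "V i \<inter> N i = {}"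
      using UN(8)[OF i] VX(1)[OF i] unfolding Z_def by blast+
    moreover have "(Y i - V i) \<inter> N i = {}" using UN(6,7)[OF i] by blast
    ultimately show ?thesis unfolding arcs(5)[OF i, symmetric] by blast
  qed
  have EU: "E j - V j \<subseteq> U i" if ij: "i < 3" "j < 3" "i \<noteq> j" for i j
  proof (rule side[OF ij(1)])
    show "connected (E j - V j)" using arc_set_interior(1)[OF arcs(3)[OF ij(2)]] unfolding V_def .
    have "X i \<subseteq> cyc" using arcs(5)[OF ij(1)] by blast
    then show "(E j - V j) \<inter> Z i = {}"
      unfolding Z_def using equalityD1[OF arcs(8)[OF ij(2)]] EE[OF ij] by blast
    \<comment> \<open>Two chords may share one end, but not both in a simple graph. An end of chord
      \<open>j\<close> that is not shared lies inside \<open>Y i\<close>, hence in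
      \<open>U i\<close>, and pulls the chord there.\<close>
    have "\<not> V j \<subseteq> V i"
    proof
      assume "V j \<subseteq> V i"
      then have "ends G (e j) \<subseteq> ends G (e i)"
        unfolding V_def ch(2)[OF ij(1)] ch(2)[OF ij(2)] using pt_eq c_verts by blast
      moreover have "card (ends G (e i)) = 2" "card (ends G (e j)) = 2"
        using simple eE[OF ij(1)] eE[OF ij(2)] unfolding simple_graph_def by blast+
      ultimately have "ends G (e j) = ends G (e i)"
        by (metis card_2_iff card_subset_eq finite.emptyI finite.insertI)
      then show False using edge_eqI[OF eE[OF ij(2)] eE[OF ij(1)]] dist[OF ij] by simp
    qed
    then obtain v where v: "v \<in> V j" "v \<notin> V i" by blast
    then have "v \<in> U i" using VX(1)[OF ij(2)] XY[OF ij] UN(6)[OF ij(1)] by blast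
    moreover have "v \<in> closure (E j - V j)"
      using arc_set_interior(3)[OF arcs(3)[OF ij(2)]] VX(2)[OF ij(2)] v(1) unfolding V_def by blast
    ultimately show "(E j - V j) \<inter> U i \<noteq> {}"
      using open_Int_closure_eq_empty[OF UN(1)[OF ij(1)], of "E j - V j"] by blast
  qed
  have NE: "N i \<inter> E j = {}" if i: "i < 3" and j: "j < 3" for i j
  proof (cases "i = j")
    case True
    then show ?thesis using UN(8)[OF i] unfolding Z_def by blast
  next
    case False
    have "V j \<subseteq> cyc" using arcs(8)[OF j] by blast
    then show ?thesis using EU[OF i j False] UN(7)[OF i] cycN[OF i] by blast
  qed
  have NU: "N i \<subseteq> U j" if ij: "i < 3" "j < 3" "i \<noteq> j" for i j
  proof (rule side[OF ij(2) UN(4)[OF ij(1)]])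
    have "X j \<subseteq> cyc" using arcs(5)[OF ij(2)] by blast
    then show "N i \<inter> Z j = {}" unfolding Z_def using cycN[OF ij(1)] NE[OF ij(1,2)] by blast
    have "E i - V i \<noteq> {}" using arc_set_interior(2)[OF arcs(3)[OF ij(1)]] unfolding V_def .
    moreover have "E i - V i \<subseteq> closure (N i)"
      using UN(10)[OF ij(1)] unfolding Z_def frontier_def by blast
    moreover have "E i - V i \<subseteq> U j" using EU[OF ij(2,1)] ij(3) by blast
    ultimately show "N i \<inter> U j \<noteq> {}"
      using open_Int_closure_eq_empty[OF UN(1)[OF ij(2)], of "N i"] by blast
  qed
  have 0: "(0::nat) < 3" by simp
  have N0: "N 0 \<inter> (X 0 \<union> Y 0) = {}" unfolding arcs(5)[OF 0] using cycN[OF 0] by blast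
  \<comment> \<open>\<open>N 0\<close> serves only to name the two sides of the cycle; from here on
    they are interchangeable, by \<open>S I O'\<close> and \<open>S O' I\<close>.\<close>
  obtain I O' where IO: "open I" "open O'" "connected I" "connected O'" "O' \<noteq> {}" "N 0 \<subseteq> I"
    "I \<inter> O' = {}" "I \<union> O' = - (X 0 \<union> Y 0)" "frontier I = X 0 \<union> Y 0" "frontier O' = X 0 \<union> Y 0"
    by (rule two_arcs_Jordan[OF arcs(1,2)[OF 0] arcs(4)[OF 0, unfolded V_def] UN(4)[OF 0] N0 UN(5)[OF 0]])
  define S where "S R R' \<longleftrightarrow> open R \<and> open R' \<and> connected R \<and> R \<inter> R' = {} \<and> R \<union> R' = - cyc \<and>
    frontier R = cyc \<and> frontier R' = cyc" for R R'
  have S: "S I O'" "S O' I"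
    using IO unfolding S_def arcs(5)[OF 0] by (simp_all add: Int_commute Un_commute)
  have Sf: "open R" "open R'" "connected R" "R \<inter> R' = {}" "R \<union> R' = - cyc" "frontier R = cyc" "R \<inter> cyc = {}"
    if "S R R'" for R R'
    using that unfolding S_def by (simp_all, blast)
  define W where "W R = R \<inter> (U 0 \<inter> U 1 \<inter> U 2)" for R
  have WU: "W R \<subseteq> R" "i < 3 \<Longrightarrow> W R \<subseteq> U i" for R i unfolding W_def less3_cases by auto
  have WI: "x \<in> W R" if "x \<in> R" "\<And>i. i < 3 \<Longrightarrow> x \<in> U i" for x R
    using that unfolding W_def by simp
  have openW: "open (W R)" if "S R R'" for R R'
    using that UN(1) unfolding W_def S_def by (intro open_Int) auto
  define H where "H = cyc \<union> \<Union>(Z ` {..<3})"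
  have Hsk: "H \<subseteq> skeleton G D"
    using cyc_skeleton arcC_cyc im_skeleton[OF eE] unfolding H_def Z_def X_def E_def by blast
  have inW: "C \<subseteq> W R" if C: "connected C" "C \<inter> H = {}" "C \<inter> W R \<noteq> {}" and R: "S R R'" for C R R'
  proof -
    have "C \<inter> cyc = {}" using C(2) unfolding H_def by blast
    then have "C \<subseteq> R \<union> R'" unfolding Sf(5)[OF R] by blast
    moreover have "C \<inter> R \<noteq> {}" using C(3) WU(1)[of R] by blast
    ultimately have "C \<subseteq> R" using connected_subset_side[OF Sf(1,2,4)[OF R] C(1)] by blast
    moreover have "C \<subseteq> U i" if i: "i < 3" for i
    proof (rule side[OF i C(1)])
      have "Z i \<subseteq> H" using i unfolding H_def by blast
      then show "C \<inter> Z i = {}" using C(2) by blast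
      show "C \<inter> U i \<noteq> {}" using C(3) WU(2)[OF i, of R] by blast
    qed
    ultimately show ?thesis using WI by blast
  qed
  have conW: "connected (W R)" if R: "S R R'" for R R'
  proof -
    have "connected_component (W R) x y" if xy: "x \<in> W R" "y \<in> W R" for x y
    proof -
      have "connected_component (- H) x y"
        unfolding H_def
      proof (rule Janiszewski_family)
        show "compact cyc" using arcC_full[of 0] compact_arcC by metis
        show "connected_component (- cyc) x y"
        proof -
          have "R \<subseteq> - cyc" "x \<in> R" "y \<in> R" using Sf(7)[OF R] xy WU(1)[of R] by blast+
          then show ?thesis
            unfolding connected_component_def using Sf(3)[OF R] by blast
        qed
        fix i assume "i \<in> {..<3::nat}"
        then have i: "i < 3" by simp
        show "compact (Z i)" unfolding Z_def X_def E_def using compact_arcC compact_im[OF eE[OF i]] by (rule compact_Un)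
        show "connected_component (- Z i) x y"
        proof -
          have "U i \<subseteq> - Z i" "x \<in> U i" "y \<in> U i" using UN(8)[OF i] xy WU(2)[OF i, of R] by blast+
          then show ?thesis
            unfolding connected_component_def using UN(3)[OF i] by blast
        qed
        fix J assume J: "J \<subseteq> {..<3} - {i}"
        have "Z j \<inter> E i \<subseteq> V i" if j: "j \<in> J" for j
        proof -
          have "j < 3" "i \<noteq> j" using J j by auto
          then have "X j \<subseteq> cyc" "E i \<inter> E j \<subseteq> V i" using arcs(5)[of j] EE[OF i, of j] by blast+
          then show ?thesis unfolding Z_def using equalityD1[OF arcs(8)[OF i]] by blast
        qed
        moreover have "cyc \<inter> E i = V i" "X i \<subseteq> cyc" "V i \<subseteq> X i"
          using arcs(5,8)[OF i] VX(1)[OF i] by blast+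
        \<comment> \<open>\<open>Z i\<close> meets the cycle and the other closed curves exactly in
          its own arc, which is connected. So two points of \<open>W R\<close>, separated neither by
          the cycle nor by any \<open>Z i\<close>, are not separated by all of them
          together.\<close>
        ultimately have "(cyc \<union> \<Union>(Z ` J)) \<inter> Z i = X i" unfolding Z_def[of i] by blast
        then show "connected ((cyc \<union> \<Union>(Z ` J)) \<inter> Z i)"
          using arc_set_connected[OF arcs(1)[OF i]] by simp
      qed simp
      then obtain C where C: "connected C" "C \<subseteq> - H" "x \<in> C" "y \<in> C"
        unfolding connected_component_def by blast
      then have "C \<subseteq> W R" using inW[OF C(1) _ _ R] xy by blast
      then show ?thesis using C unfolding connected_component_def by blast
    qed
    then show ?thesis unfolding connected_iff_connected_component by blast
  qed
  have fuW: "face_union (W R)" if R: "S R R'" for R R'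
    unfolding face_union_def
  proof (intro conjI ballI impI)
    fix F assume F: "F \<in> drawing_faces G D" "F \<inter> W R \<noteq> {}"
    show "F \<subseteq> W R"
      using inW[OF face_facts(2)[OF F(1)] _ F(2) R] face_facts(4)[OF F(1)] Hsk by blast
  qed (use openW[OF R] conW[OF R] in auto)
  have fuN: "face_union (N i)" if i: "i < 3" for i
    unfolding face_union_def
  proof (intro conjI ballI impI)
    fix F assume F: "F \<in> drawing_faces G D" "F \<inter> N i \<noteq> {}"
    have "Z i \<subseteq> H" using i unfolding H_def by blast
    then show "F \<subseteq> N i"
      using sideN[OF i face_facts(2)[OF F(1)] _ F(2)] face_facts(4)[OF F(1)] Hsk by blast
  qed (use UN(2,4)[OF i] in auto)
  have EN: "E i - V i \<subseteq> R" if i: "i < 3" and R: "S R R'" and NR: "N i \<subseteq> R" for i R R'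
  proof -
    have "E i \<subseteq> closure R"
      using UN(10)[OF i] closure_mono[OF NR] unfolding Z_def frontier_def by blast
    moreover have "closure R \<subseteq> R \<union> cyc"
      using Sf(1,6)[OF R] by (auto simp: frontier_def interior_open)
    ultimately show ?thesis using equalityD1[OF arcs(8)[OF i]] by blast
  qed
  have touch: "\<exists>f\<in>edges G. \<exists>p\<in>im f. p \<notin> pt ` verts G \<and> p \<in> closure (W R) \<and> p \<in> closure (N i)"
    if i: "i < 3" and R: "S R R'" "S R' R" for i R R'
  proof -
    define U' where "U' = (\<Inter>j\<in>{..<3} - {i}. U j)"
    have U': "open U'" unfolding U'_def using UN(1) by (intro open_INT) auto
    have W': "W R = R \<inter> U' \<inter> U i"
      using i unfolding W_def U'_def less3_cases by (auto simp: less3_cases)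
    have clN: "Z i \<subseteq> closure (N i)" using UN(10)[OF i] unfolding frontier_def by blast
    have "N i \<subseteq> R \<union> R'" unfolding Sf(5)[OF R(1)] using cycN[OF i] by blast
    then consider "N i \<subseteq> R" | "N i \<subseteq> R'"
      using connectedD[OF UN(4)[OF i] Sf(1,2)[OF R(1)]] Sf(4)[OF R(1)] by blast
    then show ?thesis
    proof cases
      case 1
      \<comment> \<open>On the side where the chord is drawn, \<open>W R\<close> and
        \<open>N i\<close> touch along the chord.\<close>
      obtain p where p: "p \<in> E i - V i" using arc_set_interior(2)[OF arcs(3)[OF i]] unfolding V_def by blast
      have "p \<in> U'" unfolding U'_def using EU[OF _ i] p by blast
      moreover have "p \<in> R" using EN[OF i R(1) 1] p by blast
      moreover have "p \<in> closure (U i)" using UN(9)[OF i] p unfolding Z_def frontier_def by blast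
      moreover have "open (R \<inter> U')" using U' Sf(1)[OF R(1)] by blast
      ultimately have "p \<in> closure (W R)"
        unfolding W' using open_Int_closure_subset[of "R \<inter> U'" "U i"] by blast
      moreover have "p \<notin> pt ` verts G" using equalityD1[OF EV[OF i]] p by blast
      moreover have "p \<in> closure (N i)" using clN p unfolding Z_def by blast
      ultimately show ?thesis using eE[OF i] p unfolding E_def by blast
    next
      case 2
      \<comment> \<open>On the other side they touch along the arc \<open>X i\<close>. Its first
        edge is used, and any inner point of that edge will do.\<close>
      let ?f = "ed (a i)"
      have ne: "c (a i) \<noteq> c (Suc (a i))" using n3 by (simp add: c_window)
      have arcf: "arc_set (im ?f) (pt (c (a i))) (pt (c (Suc (a i))))"
        by (rule edge_arc_set[OF ed ne])
      then obtain p where p: "p \<in> im ?f" "p \<notin> {pt (c (a i)), pt (c (Suc (a i)))}"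
        using arc_set_interior(2) by blast
      have "im ?f \<inter> pt ` verts G = {pt (c (a i)), pt (c (Suc (a i)))}"
        using im_verts[OF ed(1)] ed(2) by simp
      then have pV: "p \<notin> pt ` verts G" using p by blast
      have pX: "p \<in> X i" using p ab(1)[OF i] unfolding X_def arcC_def by auto
      have "p \<in> U'" unfolding U'_def
      proof
        fix j assume "j \<in> {..<3} - {i}"
        then have j: "j < 3" "j \<noteq> i" by auto
        show "p \<in> U j" using XY[OF j(1) i j(2)] UN(6)[OF j(1)] pX pV VV[of j] by blast
      qed
      moreover have "p \<in> closure R" using Sf(6)[OF R(1)] pX arcs(5)[OF i] unfolding frontier_def by blast
      ultimately have "p \<in> closure (U' \<inter> R)" using open_Int_closure_subset[OF U', of R] by blast
      \<comment> \<open>Chord \<open>i\<close> cuts nothing off from this side: neither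
        \<open>Z i\<close> nor \<open>N i\<close> meets \<open>R\<close>.\<close>
      moreover have "R \<subseteq> U i"
      proof -
        have "R \<inter> cyc = {}" "R \<inter> R' = {}" using Sf(4,7)[OF R(1)] by simp_all
        moreover have "E i - V i \<subseteq> R'" using EN[OF i R(2) 2] .
        moreover have "V i \<subseteq> cyc" "X i \<subseteq> cyc" using arcs(5,8)[OF i] by blast+
        ultimately have "R \<inter> Z i = {}" "R \<inter> N i = {}" using 2 unfolding Z_def by blast+
        then show ?thesis using UN(8)[OF i] by blast
      qed
      then have "U' \<inter> R = W R" unfolding W' by blast
      moreover have "p \<in> closure (N i)" using clN pX unfolding Z_def by blast
      ultimately show ?thesis using ed(1)[of "a i"] p(1) pV by auto
    qed
  qed
  have adj: "\<exists>f\<in>edges dual. \<exists>F\<in>faces_in (W R). \<exists>F'\<in>faces_in (N i). ends dual f = {F, F'}"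
    if i: "i < 3" and R: "S R R'" "S R' R" for i R R'
  proof -
    obtain f p where f: "f \<in> edges G" "p \<in> im f" "p \<notin> pt ` verts G" "p \<in> closure (W R)" "p \<in> closure (N i)"
      using touch[OF i R] by blast
    obtain F where F: "F \<in> faces_in (W R)" "p \<in> closure F"
      using face_union_cover[OF fuW[OF R(1)] f(4)] by blast
    obtain F' where F': "F' \<in> faces_in (N i)" "p \<in> closure F'"
      using face_union_cover[OF fuN[OF i] f(5)] by blast
    have FD: "F \<in> drawing_faces G D" "F' \<in> drawing_faces G D" "F \<subseteq> W R" "F' \<subseteq> N i"
      using F F' by (auto simp: faces_in_def)
    have "W R \<inter> N i = {}" using WU(2)[OF i] UN(7)[OF i] by blast
    then have "F \<noteq> F'" using FD face_facts(3)[OF FD(1)] by blast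
    then have "ends dual f = {F, F'}" using dual_ends[OF f(1-3) FD(1,2)] F(2) F'(2) by blast
    then show ?thesis using f(1) F F' unfolding dual_simps(2) by blast
  qed
  have disj: "faces_in P \<inter> faces_in Q = {}" if "P \<inter> Q = {}" for P Q
    using that face_facts(3) unfolding faces_in_def by blast
  obtain D' Of where D': "plane_drawing dual D'" "Of \<in> drawing_faces dual D'"
    "\<forall>v\<in>verts dual. point D' v \<in> frontier Of"
    using outer unfolding outerplanar_def by blast
  interpret dg: plane_graph dual D'
    using dual_finite D'(1) by unfold_locales
  show False
  proof (rule dg.no_K23_minor[OF D'(2), of "faces_in (W I)" "faces_in (W O')" "\<lambda>i. faces_in (N i)"])
    show "faces_in (W I) \<subseteq> verts dual" "faces_in (W O') \<subseteq> verts dual"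
      "faces_in (N i) \<subseteq> verts dual" for i unfolding dual_simps faces_in_def by auto
    show "faces_in (W I) \<inter> faces_in (W O') = {}" using IO(7) WU(1) by (intro disj) blast
    fix i :: nat assume i: "i < 3"
    show "faces_in (W I) \<inter> faces_in (N i) = {}" "faces_in (W O') \<inter> faces_in (N i) = {}"
      using WU(2)[OF i] UN(7)[OF i] by (intro disj; blast)+
    show "faces_in (N i) \<inter> faces_in (N j) = {}" if "j < 3" "i \<noteq> j" for j
      using NU[OF i that] UN(7)[OF that(1)] by (intro disj) blast
    show "(u, v) \<in> (adjacency dual \<inter> faces_in (N i) \<times> faces_in (N i))\<^sup>*"
      if "u \<in> faces_in (N i)" "v \<in> faces_in (N i)" for u v
      using faces_in_connected[OF fuN[OF i] that] .
    show "\<exists>f\<in>edges dual. \<exists>F\<in>faces_in (W I). \<exists>F'\<in>faces_in (N i). ends dual f = {F, F'}"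
      using adj[OF i S] .
    show "\<exists>f\<in>edges dual. \<exists>F\<in>faces_in (W O'). \<exists>F'\<in>faces_in (N i). ends dual f = {F, F'}"
      using adj[OF i S(2,1)] .
  next
    show "(u, v) \<in> (adjacency dual \<inter> faces_in (W I) \<times> faces_in (W I))\<^sup>*"
      if "u \<in> faces_in (W I)" "v \<in> faces_in (W I)" for u v
      using faces_in_connected[OF fuW[OF S(1)] that] .
    show "(u, v) \<in> (adjacency dual \<inter> faces_in (W O') \<times> faces_in (W O'))\<^sup>*"
      if "u \<in> faces_in (W O')" "v \<in> faces_in (W O')" for u v
      using faces_in_connected[OF fuW[OF S(2)] that] .
    show "point D' v \<in> frontier Of" if "v \<in> verts dual" for v
      using D'(3) that by simp
  qed
qed

end

section \<open>Reindexing arcs, and the side of a chord on which vertices lie\<close>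

context plane_ham
begin

lemma c_add_cong: "c i = c j \<Longrightarrow> c (i + d) = c (j + d)"
  unfolding c_eq by (metis mod_add_left_eq)

text \<open>Equal end vertices force equal lengths, as both lengths are below \<open>n\<close>; the
  two index intervals are then translates of each other modulo \<open>n\<close>.\<close>

lemma arcC_cong:
  assumes "c k = c k'" "c l = c l'" "k < l" "l < k + n" "k' < l'" "l' < k' + n"
  shows "arcC k l = arcC k' l'" "c ` {k..l} = c ` {k'..l'}"
proof -
  define d where "d = l - k"
  have l: "l = k + d" using assms by (simp add: d_def)
  have "c (k' + d) = c (k' + (l' - k'))"
    using c_add_cong[OF assms(1), of d] assms l by simp
  then have "k' + d = k' + (l' - k')" using assms by (subst (asm) c_window) (auto simp: d_def)
  then have l': "l' = k' + d" using assms by simp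
  have ced: "c (k + t) = c (k' + t)" "ed (k + t) = ed (k' + t)" for t
    using c_add_cong[OF assms(1), of t] ed_mod[of "k + t" "k' + t"] c_eq by auto
  have im1: "{k..<k + d} = (+) k ` {..<d}" "{k..k + d} = (+) k ` {..d}" for k
    by (simp_all add: image_add_atLeastLessThan lessThan_atLeast0 atMost_atLeast0 add.commute)
  show "arcC k l = arcC k' l'" unfolding arcC_def l l' im1 by (simp add: ced)
  show "c ` {k..l} = c ` {k'..l'}" unfolding l l' im1 image_image by (simp add: ced)
qed

lemma arcC_mono: "a' \<le> a \<Longrightarrow> b \<le> b' \<Longrightarrow> arcC a b \<subseteq> arcC a' b'"
  unfolding arcC_def by (intro UN_mono) auto

lemma arcC_shift: "a < b \<Longrightarrow> b < a + n \<Longrightarrow> arcC a b = arcC (a + n) (b + n)"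
  by (intro arcC_cong) (simp_all add: per)

text \<open>The complementary arc without its ends is connected, misses the closed curve and
  contains all vertices off the first arc. So it depends only on the chord and the arc, not on the
  vertex, on which side those vertices are.\<close>

lemma chord_side_const:
  assumes e: "chord e" "ends G e = {c i, c j}" "i < j" "j < i + n"
    and uv: "u \<in> verts G - c ` {i..j}" "v \<in> verts G - c ` {i..j}"
  shows "connected_component (- (im e \<union> arcC i j)) (pt u) (pt v)"
proof -
  let ?C = "arcC j (i + n) - {pt (c i), pt (c j)}"
  note ac = arcC_complement[OF e(3,4)]
  have ct: "arcC j (i + n) \<inter> im e = {pt (c i), pt (c j)}" using chord_theta(3)[OF e] .
  have "connected ?C" using arc_set_interior(1)[OF ac(3)] .
  moreover have "?C \<subseteq> - (im e \<union> arcC i j)"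
    using equalityD1[OF ct] equalityD1[OF ac(1)] by blast
  moreover have "pt w \<in> ?C" if w: "w \<in> verts G - c ` {i..j}" for w
  proof -
    have "w \<in> c ` {j..i + n}" using ac(5) w by blast
    then have "pt w \<in> arcC j (i + n)" using pt_in_arcC[of j "i + n" w] e w by simp
    moreover have "w \<noteq> c i" "w \<noteq> c j" using w e by auto
    ultimately show ?thesis using pt_eq[of w] w by simp
  qed
  ultimately show ?thesis unfolding connected_component_def using uv by blast
qed

end

section \<open>Realizers\<close>

text \<open>The rank of \<open>v\<close> counts the members of the chain that miss \<open>v\<close>,
  and the threshold of \<open>\<S>\<close> counts those that do not contain its intersection. If
  \<open>v\<close> lies outside some \<open>A\<close> in \<open>\<S>\<close>, then \<open>v\<close>
  is missed by all members counted for the threshold, as these are contained in \<open>A\<close>,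
  and by \<open>A\<close> itself, so its rank exceeds the threshold.\<close>

lemma chain_rank:
  assumes fin: "finite \<L>" and chain: "\<And>A B. A \<in> \<L> \<Longrightarrow> B \<in> \<L> \<Longrightarrow> A \<subseteq> B \<or> B \<subseteq> A"
  shows "\<exists>f :: 'a \<Rightarrow> nat. \<forall>\<S>\<subseteq>\<L>. \<exists>g. \<forall>v. v \<in> \<Inter>\<S> \<longleftrightarrow> f v \<le> g"
proof (intro exI allI impI)
  fix \<S> v assume S: "\<S> \<subseteq> \<L>"
  let ?f = "{L \<in> \<L>. v \<notin> L}" and ?g = "{L \<in> \<L>. \<not> \<Inter>\<S> \<subseteq> L}"
  show "v \<in> \<Inter>\<S> \<longleftrightarrow> card ?f \<le> card ?g"
  proof
    assume "v \<in> \<Inter>\<S>"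
    then show "card ?f \<le> card ?g" using fin by (intro card_mono) auto
  next
    assume le: "card ?f \<le> card ?g"
    show "v \<in> \<Inter>\<S>"
    proof (rule ccontr)
      assume "v \<notin> \<Inter>\<S>"
      then obtain A where A: "A \<in> \<S>" "v \<notin> A" by blast
      have "v \<notin> L" if L: "L \<in> \<L>" "\<not> \<Inter>\<S> \<subseteq> L" for L
      proof -
        have "\<not> A \<subseteq> L" using A(1) L(2) by blast
        then show ?thesis using chain[of A L] A S L(1) by blast
      qed
      moreover have "\<Inter>\<S> \<subseteq> A" using A(1) by blast
      ultimately have "?g \<subset> ?f" using A S by blast
      then have "card ?g < card ?f" using fin by (intro psubset_card_mono) auto
      then show False using le by simp
    qed
  qed
qed

definition lex_rel :: "'a set \<Rightarrow> ('a \<Rightarrow> nat) \<Rightarrow> 'a rel \<Rightarrow> 'a rel" where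
  "lex_rel A key r = {(x, y). x \<in> A \<and> y \<in> A \<and> (key x < key y \<or> key x = key y \<and> (x, y) \<in> r)}"

lemma linear_order_lex_rel:
  assumes "linear_order_on A r"
  shows "linear_order_on A (lex_rel A key r)"
proof -
  have r: "refl_on A r" "trans r" "antisym r" "total_on A r"
    using assms by (auto simp: linear_order_on_def partial_order_on_def preorder_on_def)
  have "refl_on A (lex_rel A key r)"
    using r(1) by (auto simp: refl_on_def lex_rel_def)
  moreover have "trans (lex_rel A key r)"
    by (rule transI) (auto simp: lex_rel_def dest: transD[OF r(2)])
  moreover have "antisym (lex_rel A key r)"
    by (rule antisymI) (auto simp: lex_rel_def dest: antisymD[OF r(3)])
  moreover have "total_on A (lex_rel A key r)"
    using r(4) by (auto simp: total_on_def lex_rel_def)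
  moreover have "lex_rel A key r \<subseteq> A \<times> A"
    by (auto simp: lex_rel_def)
  ultimately show ?thesis
    by (simp add: linear_order_on_def partial_order_on_def preorder_on_def)
qed

text \<open>
  Two linear orders reverse all incomparable vertex-face pairs. A third one, which puts all vertices
  below all faces and is opposite to the first on either side, reverses the rest.
\<close>

lemma order_dim_le_3:
  fixes M :: "('v, 'e) map" and f1 f2 :: "'v \<Rightarrow> nat" and g1 g2 :: "complex set \<Rightarrow> nat"
  assumes inc: "\<And>v F. v \<in> verts (fst M) \<Longrightarrow> F \<in> faces M \<Longrightarrow>
    point (snd M) v \<in> frontier F \<longleftrightarrow> f1 v \<le> g1 F \<and> f2 v \<le> g2 F"
  shows "order_dim (VF_carrier M) (VF_order M) \<le> 3"
proof -
  let ?A = "VF_carrier M"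
  obtain r where "well_order_on ?A r" using well_order_on by blast
  then have r: "linear_order_on ?A r" by (simp add: well_order_on_def)
  \<comment> \<open>Vertices get even keys and faces odd ones, so a vertex never ties with a face,
    and \<open>2 * f1 v < 2 * g1 F + 1\<close> says exactly that
    \<open>f1 v \<le> g1 F\<close>.\<close>
  define k1 where "k1 = case_sum (\<lambda>v. 2 * f1 v) (\<lambda>F::complex set. 2 * g1 F + 1)"
  define k2 where "k2 = case_sum (\<lambda>v. 2 * f2 v) (\<lambda>F::complex set. 2 * g2 F + 1)"
  define L1 where "L1 = lex_rel ?A k1 r"
  define L2 where "L2 = lex_rel ?A k2 r"
  define L3 where "L3 = lex_rel ?A (\<lambda>x. if isl x then 0 else 1) (L1\<inverse>)"
  have lin1: "linear_order_on ?A L1" and lin2: "linear_order_on ?A L2"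
    unfolding L1_def L2_def using linear_order_lex_rel[OF r] by blast+
  have lin3: "linear_order_on ?A L3"
    unfolding L3_def using lin1 by (intro linear_order_lex_rel) simp
  have L3: "(x, y) \<in> L3 \<longleftrightarrow> x \<in> ?A \<and> y \<in> ?A \<and> (isl x \<and> \<not> isl y \<or> isl x = isl y \<and> (y, x) \<in> L1)" for x y
    unfolding L3_def lex_rel_def by auto
  have Inl_in: "Inl v \<in> ?A \<longleftrightarrow> v \<in> verts (fst M)" and Inr_in: "Inr F \<in> ?A \<longleftrightarrow> F \<in> faces M" for v F
    by (auto simp: VF_carrier_def)
  have vF: "(Inl v, Inr F) \<in> L1 \<inter> L2 \<longleftrightarrow> v \<in> verts (fst M) \<and> F \<in> faces M \<and> f1 v \<le> g1 F \<and> f2 v \<le> g2 F"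
    for v F
    unfolding L1_def L2_def lex_rel_def k1_def k2_def by (auto simp: Inl_in Inr_in; presburger)
  have anti: "(x, y) \<in> L1 \<Longrightarrow> (y, x) \<in> L1 \<Longrightarrow> x = y" for x y
    using lin1 unfolding linear_order_on_def partial_order_on_def antisym_def by blast
  have ref: "(x, x) \<in> L1 \<inter> L2 \<inter> L3" if "x \<in> ?A" for x
    using lin1 lin2 lin3 that
    unfolding linear_order_on_def partial_order_on_def preorder_on_def refl_on_def by blast
  have "L1 \<inter> L2 \<inter> L3 = VF_order M"
  proof (rule set_eqI, clarify)
    fix x y
    show "(x, y) \<in> L1 \<inter> L2 \<inter> L3 \<longleftrightarrow> (x, y) \<in> VF_order M"
    proof
      assume xy: "(x, y) \<in> L1 \<inter> L2 \<inter> L3"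
      then have A: "x \<in> ?A" "y \<in> ?A" by (auto simp: L3)
      show "(x, y) \<in> VF_order M"
      proof (cases "isl x = isl y")
        case True
        then have "(y, x) \<in> L1" using xy by (auto simp: L3)
        then have "x = y" using anti xy by blast
        then show ?thesis using A by (simp add: VF_order_def Id_on_def)
      next
        case False
        then have "isl x" "\<not> isl y" using xy by (auto simp: L3)
        then obtain v F where vw: "x = Inl v" "y = Inr F" by (metis isl_def sum.exhaust_sel)
        then have "v \<in> verts (fst M)" "F \<in> faces M" "f1 v \<le> g1 F" "f2 v \<le> g2 F"
          using vF[of v F] xy by auto
        then show ?thesis using inc vw by (simp add: VF_order_def)
      qed
    next
      assume "(x, y) \<in> VF_order M"
      then consider "x = y" "x \<in> ?A" |
        v F where "x = Inl v" "y = Inr F" "v \<in> verts (fst M)" "F \<in> faces M" "point (snd M) v \<in> frontier F"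
        unfolding VF_order_def Id_on_def by blast
      then show "(x, y) \<in> L1 \<inter> L2 \<inter> L3"
      proof cases
        case 1
        then show ?thesis using ref by simp
      next
        case 2
        then have "(x, y) \<in> L1 \<inter> L2" using vF[of v F] inc[of v F] by simp
        moreover have "(x, y) \<in> L3" using 2 by (simp add: L3 Inl_in Inr_in)
        ultimately show ?thesis by simp
      qed
    qed
  qed
  then have "realizer ?A (VF_order M) {L1, L2, L3}"
    unfolding realizer_def using lin1 lin2 lin3 by auto
  then have "order_dim ?A (VF_order M) \<le> enat (card {L1, L2, L3})"
    unfolding order_dim_def by (intro INF_lower) simp
  also have "\<dots> \<le> enat 3" using card_insert_le_m1 by (simp add: card_insert_if)
  finally show ?thesis by (simp add: numeral_eq_enat)
qed

section \<open>Ranks of vertices and faces along the two chains\<close>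

context plane_ham_dual
begin

text \<open>With the indices starting at the shortest chord, each chord gets an interval from
  \<open>p e\<close> to \<open>q e\<close> inside the window from \<open>m\<close> to
  \<open>n\<close>. The right arcs \<open>R e\<close> belong to these intervals and the left arcs
  \<open>L e\<close> are their complements with the ends added; as the intervals are nested, both
  families are chains, in opposite orders.\<close>

lemma ranks_if_shortest_chord:
  assumes outer: "outerplanar dual"
    and nc: "\<And>e f i j k l. chord e \<Longrightarrow> ends G e = {c i, c j} \<Longrightarrow> chord f \<Longrightarrow> ends G f = {c k, c l} \<Longrightarrow>
      i < k \<Longrightarrow> k < j \<Longrightarrow> j < l \<Longrightarrow> l < i + n \<Longrightarrow> False"
    and e0: "chord e0" "ends G e0 = {c 0, c m}" "0 < m" "m < n"
    and short: "\<And>e i j. chord e \<Longrightarrow> ends G e = {c i, c j} \<Longrightarrow> i < j \<Longrightarrow> j < i + n \<Longrightarrow> i + m \<le> j"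
  obtains f1 f2 :: "'a \<Rightarrow> nat" and g1 g2 :: "complex set \<Rightarrow> nat" where
    "\<And>v F. v \<in> verts G \<Longrightarrow> F \<in> drawing_faces G D \<Longrightarrow>
      pt v \<in> frontier F \<longleftrightarrow> f1 v \<le> g1 F \<and> f2 v \<le> g2 F"
proof -
  have cn: "c n = c 0" using per[of 0] by simp
  have "\<exists>p q. ends G e = {c p, c q} \<and> m \<le> p \<and> p < q \<and> q \<le> n" if e: "chord e" for e
  proof -
    have "e \<in> edges G" using e by (simp add: chord_def)
    then obtain i j where ij: "ends G e = {c i, c j}" "0 \<le> i" "i < j" "j < 0 + n"
      by (rule edge_ends_window)
    consider "j \<le> m" | "m \<le> i" | "i = 0" "m < j" | "0 < i" "i < m" "m < j" by linarith
    then show ?thesis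
    proof cases
      case 1
      \<comment> \<open>By minimality only the chord with the ends of \<open>e0\<close> is left. Its
        end \<open>c 0\<close> is rewritten as \<open>c n\<close>, so its interval is the whole
        window.\<close>
      then have "i = 0" "j = m" using short[OF e ij(1,3)] ij by auto
      then show ?thesis using ij e0 cn by (intro exI[of _ m] exI[of _ n]) auto
    next
      case 2
      then show ?thesis using ij by (intro exI[of _ i] exI[of _ j]) auto
    next
      case 3
      then show ?thesis using ij cn by (intro exI[of _ j] exI[of _ n]) auto
    next
      case 4
      then show ?thesis using nc[OF e0(1,2) e ij(1)] ij by auto
    qed
  qed
  then obtain p q where pq: "\<And>e. chord e \<Longrightarrow> ends G e = {c (p e), c (q e)} \<and> m \<le> p e \<and> p e < q e \<and> q e \<le> n"
    by metis
  have pe: "ends G e = {c (p e), c (q e)}" "m \<le> p e" "p e < q e" "q e \<le> n" "q e < p e + n"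
    "p e + n < q e + n" "ends G e = {c (q e), c (p e + n)}"
    if "chord e" for e
    using pq[OF that] e0(3) by (auto simp: per)
  have e0p: "p e0 = m" "q e0 = n"
  proof -
    have "c (p e0) \<in> {c 0, c m}" "c (q e0) \<in> {c 0, c m}" using pe(1)[OF e0(1)] e0(2) by auto
    moreover have "c (p e0) \<noteq> c 0" using pe[OF e0(1)] e0(3) by (subst c_window) auto
    ultimately have "c (p e0) = c m" by simp
    then show "p e0 = m" using pe[OF e0(1)] e0(3,4) by (subst (asm) c_window) auto
    then have "c (q e0) \<noteq> c m" using pe[OF e0(1)] e0(3,4) by (subst c_window) auto
    then have "c (q e0) = c n" using \<open>c (q e0) \<in> {c 0, c m}\<close> cn by simp
    then show "q e0 = n" using pe[OF e0(1)] e0(3,4) by (subst (asm) c_window) auto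
  qed
  have not_apart: False if ef: "chord e" "chord f" and lt: "q e \<le> p f" for e f
  proof -
    \<comment> \<open>The interval of \<open>e0\<close> is the whole window, whereas that of
      \<open>e\<close> ends before \<open>n\<close> and that of \<open>f\<close> begins after
      \<open>m\<close>. So \<open>e0\<close>, \<open>e\<close> and \<open>f\<close> are three chords
      that cut off disjoint arcs.\<close>
    have d: "e \<noteq> e0" "f \<noteq> e0" "e \<noteq> f" using pe[OF ef(1)] pe[OF ef(2)] lt e0p by auto
    define h where "h = (\<lambda>i::nat. if i = 0 then e0 else if i = 1 then e else f)"
    define a where "a = (\<lambda>i::nat. if i = 0 then 0 else if i = 1 then p e else p f)"
    define b where "b = (\<lambda>i::nat. if i = 0 then m else if i = 1 then q e else q f)"
    show False
    proof (rule no_facing_chords[OF outer, of h a b])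
      fix i :: nat assume i: "i < 3"
      show "chord (h i)" "ends G (h i) = {c (a i), c (b i)}" "a i < b i" "b i < a i + n"
        using ef e0 pe(1,3,5)[OF ef(1)] pe(1,3,5)[OF ef(2)] by (auto simp: h_def a_def b_def)
      fix j :: nat assume j: "j < 3" "i \<noteq> j"
      show "h i \<noteq> h j" using i j d by (auto simp: h_def less3_cases)
      have s0: "arcC 0 m = arcC n (m + n)" using arcC_shift[of 0 m] e0 by simp
      have se: "arcC (p e) (q e) = arcC (p e + n) (q e + n)" using arcC_shift pe[OF ef(1)] by blast
      note le = pe(2-4)[OF ef(1)] pe(2-4)[OF ef(2)] lt
      have "arcC (p e) (q e) \<subseteq> arcC m n" "arcC (p f) (q f) \<subseteq> arcC m n"
        using le by (simp_all add: arcC_mono)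
      moreover have "arcC 0 m \<subseteq> arcC (q e) (p e + n)" "arcC 0 m \<subseteq> arcC (q f) (p f + n)"
        unfolding s0 using le by (simp_all add: arcC_mono)
      moreover have "arcC (p f) (q f) \<subseteq> arcC (q e) (p e + n)"
        using le by (simp add: arcC_mono)
      moreover have "arcC (p e) (q e) \<subseteq> arcC (q f) (p f + n)"
        unfolding se using le by (intro arcC_mono) simp_all
      ultimately show "arcC (a j) (b j) \<subseteq> arcC (b i) (a i + n)"
        using i j by (auto simp: a_def b_def less3_cases)
    qed
  qed
  \<comment> \<open>Intervals that are apart contradict \<open>not_apart\<close> and overlapping
    ones the absence of crossings.\<close>
  have nested: "p e \<le> p f \<and> q f \<le> q e \<or> p f \<le> p e \<and> q e \<le> q f" if ef: "chord e" "chord f" for e f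
  proof (rule ccontr)
    assume *: "\<not> ?thesis"
    have "\<not> q e \<le> p f" "\<not> q f \<le> p e" using not_apart ef by blast+
    moreover have "q f < p e + n" "q e < p f + n" using pe[OF ef(1)] pe[OF ef(2)] e0(3) by auto
    ultimately show False
      using * nc[OF ef(1) pe(1)[OF ef(1)] ef(2) pe(1)[OF ef(2)]]
        nc[OF ef(2) pe(1)[OF ef(2)] ef(1) pe(1)[OF ef(1)]] by linarith
  qed
  define R where "R e = c ` {p e..q e}" for e
  define L where "L e = c ` {q e..p e + n}" for e
  define CH where "CH = {e. chord e}"
  have "CH \<subseteq> edges G" by (auto simp: CH_def chord_def)
  then have finC: "finite CH" using finite_multigraph finite_subset unfolding finite_multigraph_def by blast
  have RL: "R f \<subseteq> R e" "L e \<subseteq> L f" if "p e \<le> p f" "q f \<le> q e" for e f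
    unfolding R_def L_def using that by (intro image_mono; simp)+
  have chR: "A \<subseteq> B \<or> B \<subseteq> A" if AB: "A \<in> R ` CH" "B \<in> R ` CH" for A B
  proof -
    obtain e f where ef: "chord e" "chord f" "A = R e" "B = R f" using AB unfolding CH_def by blast
    then show ?thesis using nested[OF ef(1,2)] RL(1) by metis
  qed
  have chL: "A \<subseteq> B \<or> B \<subseteq> A" if AB: "A \<in> L ` CH" "B \<in> L ` CH" for A B
  proof -
    obtain e f where ef: "chord e" "chord f" "A = L e" "B = L f" using AB unfolding CH_def by blast
    then show ?thesis using nested[OF ef(1,2)] RL(2) by metis
  qed
  obtain f1 :: "'a \<Rightarrow> nat" where f1: "\<forall>\<S>\<subseteq>L ` CH. \<exists>g. \<forall>v. v \<in> \<Inter>\<S> \<longleftrightarrow> f1 v \<le> g"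
    using chain_rank[OF finite_imageI[OF finC] chL] by blast
  obtain f2 :: "'a \<Rightarrow> nat" where f2: "\<forall>\<S>\<subseteq>R ` CH. \<exists>g. \<forall>v. v \<in> \<Inter>\<S> \<longleftrightarrow> f2 v \<le> g"
    using chain_rank[OF finite_imageI[OF finC] chR] by blast
  have "\<exists>g h. \<forall>v\<in>verts G. pt v \<in> frontier F \<longleftrightarrow> f1 v \<le> g \<and> f2 v \<le> h"
    if F: "F \<in> drawing_faces G D" for F
  proof -
    obtain x where x: "x \<in> F" using face_facts(3)[OF F] by blast
    define a where "a e v \<longleftrightarrow> connected_component (- (im e \<union> arcC (p e) (q e))) x (pt v)" for e v
    define b where "b e v \<longleftrightarrow> connected_component (- (im e \<union> arcC (q e) (p e + n))) x (pt v)" for e v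
    \<comment> \<open>A right arc is selected if the curve formed by it and its chord separates
      \<open>F\<close> from vertices off the arc; then all boundary vertices of \<open>F\<close> are
      on the arc. By \<open>chord_side_const\<close> it is immaterial which vertex off the arc is
      tested.\<close>
    define SR where "SR = R ` {e \<in> CH. \<exists>v\<in>verts G - R e. \<not> a e v}"
    define SL where "SL = L ` {e \<in> CH. \<exists>v\<in>verts G - L e. \<not> b e v}"
    have inc: "pt v \<in> frontier F \<longleftrightarrow> v \<in> \<Inter>SL \<and> v \<in> \<Inter>SR" if v: "v \<in> verts G" for v
    proof (intro iffI conjI)
      assume fr: "pt v \<in> frontier F"
      show "v \<in> \<Inter>SR"
      proof (rule ccontr)
        assume "v \<notin> \<Inter>SR"
        then obtain e u where e: "chord e" "v \<notin> R e" "u \<in> verts G - R e" "\<not> a e u"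
          unfolding SR_def CH_def by blast
        have "a e v" unfolding a_def
          using face_on_vertex_side[OF F x v fr e(2)[unfolded R_def] e(1)] pe[OF e(1)] by blast
        moreover have "connected_component (- (im e \<union> arcC (p e) (q e))) (pt v) (pt u)"
          using chord_side_const[OF e(1) pe(1,3,5)[OF e(1)]] e v unfolding R_def by blast
        ultimately show False using e(4) connected_component_trans unfolding a_def by blast
      qed
      show "v \<in> \<Inter>SL"
      proof (rule ccontr)
        assume "v \<notin> \<Inter>SL"
        then obtain e u where e: "chord e" "v \<notin> L e" "u \<in> verts G - L e" "\<not> b e u"
          unfolding SL_def CH_def by blast
        have "b e v" unfolding b_def
          using face_on_vertex_side[OF F x v fr e(2)[unfolded L_def] e(1)] pe[OF e(1)] by blast
        moreover have "connected_component (- (im e \<union> arcC (q e) (p e + n))) (pt v) (pt u)"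
          using chord_side_const[OF e(1) pe(7,5,6)[OF e(1)]] e v unfolding L_def by blast
        ultimately show False using e(4) connected_component_trans unfolding b_def by blast
      qed
    next
      assume S: "v \<in> \<Inter>SL \<and> v \<in> \<Inter>SR"
      obtain s where s: "v = c s" using v verts_window[of 0] by blast
      show "pt v \<in> frontier F" unfolding s
      proof (rule vertex_on_face_if[OF F x])
        fix e k l assume e: "chord e" "ends G e = {c k, c l}" and kl: "s < k" "k < l" "l < s + n"
        have vkl: "v \<notin> c ` {k..l}" unfolding s using kl by (auto simp: c_window)
        have "{c k, c l} = {c (p e), c (q e)}" using e(2) pe(1)[OF e(1)] by simp
        \<comment> \<open>Depending on where \<open>s\<close> is, the arc from \<open>c k\<close> to
          \<open>c l\<close> that avoids it is the right or the left arc of the chord.\<close>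
        then consider "c k = c (p e)" "c l = c (q e)" | "c k = c (q e)" "c l = c (p e + n)"
          by (auto simp: doubleton_eq_iff per)
        then show "connected_component (- (im e \<union> arcC k l)) x (pt (c s))"
        proof cases
          case 1
          note eq = arcC_cong[OF 1 kl(2) _ pe(3,5)[OF e(1)]]
          have "v \<notin> R e" using vkl eq(2) kl unfolding R_def by simp
          then have "a e v" using S e(1) v unfolding SR_def CH_def by blast
          then show ?thesis unfolding a_def s using eq(1) kl by simp
        next
          case 2
          note eq = arcC_cong[OF 2 kl(2) _ pe(5,6)[OF e(1)]]
          have "v \<notin> L e" using vkl eq(2) kl unfolding L_def by simp
          then have "b e v" using S e(1) v unfolding SL_def CH_def by blast
          then show ?thesis unfolding b_def s using eq(1) kl by simp
        qed
      qed
    qed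
    have "SL \<subseteq> L ` CH" "SR \<subseteq> R ` CH" unfolding SL_def SR_def by auto
    then obtain g h where "\<forall>v. v \<in> \<Inter>SL \<longleftrightarrow> f1 v \<le> g" "\<forall>v. v \<in> \<Inter>SR \<longleftrightarrow> f2 v \<le> h"
      using f1 f2 by meson
    then show ?thesis using inc by blast
  qed
  then obtain g1 g2 where g:
    "\<And>F. F \<in> drawing_faces G D \<Longrightarrow> \<forall>v\<in>verts G. pt v \<in> frontier F \<longleftrightarrow> f1 v \<le> g1 F \<and> f2 v \<le> g2 F"
    by metis
  show ?thesis by (rule that[of f1 g1 f2 g2]) (rule g[rule_format])
qed

text \<open>Choosing a chord of least span and rotating the cycle so that it starts at one of its
  ends reduces the claim to the previous lemma.\<close>

lemma ranks:
  assumes outer: "outerplanar dual"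
    and nc: "\<And>e f i j k l. chord e \<Longrightarrow> ends G e = {c i, c j} \<Longrightarrow> chord f \<Longrightarrow> ends G f = {c k, c l} \<Longrightarrow>
      i < k \<Longrightarrow> k < j \<Longrightarrow> j < l \<Longrightarrow> l < i + n \<Longrightarrow> False"
  obtains f1 f2 :: "'a \<Rightarrow> nat" and g1 g2 :: "complex set \<Rightarrow> nat" where
    "\<And>v F. v \<in> verts G \<Longrightarrow> F \<in> drawing_faces G D \<Longrightarrow>
      pt v \<in> frontier F \<longleftrightarrow> f1 v \<le> g1 F \<and> f2 v \<le> g2 F"
proof (cases "\<exists>e. chord e")
  case False
  have "pt v \<in> frontier F" if vF: "v \<in> verts G" "F \<in> drawing_faces G D" for v F
  proof -
    obtain x where x: "x \<in> F" using face_facts(3)[OF vF(2)] by blast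
    obtain s where s: "v = c s" using vF(1) verts_window[of 0] by blast
    show ?thesis unfolding s using False by (intro vertex_on_face_if[OF vF(2) x]) blast
  qed
  \<comment> \<open>Without chords every vertex lies on every face, so constant ranks
    suffice.\<close>
  then show ?thesis by (intro that[of "\<lambda>_. 0" "\<lambda>_. 0" "\<lambda>_. 0" "\<lambda>_. 0"]) simp
next
  case True
  \<comment> \<open>\<open>Q\<close> holds for the spans of chords. Both arcs of a chord count, so
    the least span bounds either of them from below.\<close>
  define Q where "Q m \<longleftrightarrow> (\<exists>e k. chord e \<and> ends G e = {c k, c (k + m)} \<and> 0 < m \<and> m < n)" for m
  have Qex: "Q (j - i)" if "chord e" "ends G e = {c i, c j}" "i < j" "j < i + n" for e i j
  proof -
    have "0 < j - i" "j - i < n" "i + (j - i) = j" using that(3,4) by auto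
    then show ?thesis unfolding Q_def using that(1,2) by metis
  qed
  obtain e where e: "chord e" using True by blast
  then have "e \<in> edges G" by (simp add: chord_def)
  then obtain i j where ij: "ends G e = {c i, c j}" "0 \<le> i" "i < j" "j < 0 + n"
    by (rule edge_ends_window)
  define m where "m = (LEAST m. Q m)"
  have "Q (j - i)" using Qex[OF e ij(1,3)] ij by simp
  then have "Q m" unfolding m_def by (rule LeastI)
  then obtain e0 k where e0: "chord e0" "ends G e0 = {c k, c (k + m)}" "0 < m" "m < n"
    unfolding Q_def by blast
  have least: "m \<le> m'" if "Q m'" for m' unfolding m_def using that by (rule Least_le)
  define c' where "c' i = c (k + i)" for i
  define ed' where "ed' i = ed (k + i)" for i
  interpret sh: plane_ham_dual G D c' n ed'
  proof
    show "simple_graph G" "3 \<le> n" "finite_multigraph dual" using simple n3 dual_finite by auto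
    show "c' (i + n) = c' i" for i using per[of "k + i"] by (simp add: c'_def add.assoc)
    have im: "(+) k ` {..<n} = {k..<k + n}" by (simp add: lessThan_atLeast0 image_add_atLeastLessThan add.commute)
    have "c' ` {..<n} = c ` ((+) k ` {..<n})" by (simp add: c'_def image_image)
    then show "c' ` {..<n} = verts G" unfolding im verts_window .
    show "inj_on c' {..<n}" by (auto simp: inj_on_def c'_def c_window)
    show "ed' i \<in> edges G" "ends G (ed' i) = {c' i, c' (Suc i)}" for i
      using ed[of "k + i"] by (simp_all add: ed'_def c'_def)
  qed
  have rng: "range ed' = range ed"
  proof -
    have "ed' ` {0..<0 + n} = ed ` {k..<k + n}"
    proof -
      have "(+) k ` {0..<0 + n} = {k..<k + n}" by (simp add: image_add_atLeastLessThan add.commute)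
      moreover have "ed' ` {0..<0 + n} = ed ` ((+) k ` {0..<0 + n})" unfolding ed'_def image_image ..
      ultimately show ?thesis by simp
    qed
    then show ?thesis unfolding range_ed[of k] sh.range_ed[of 0] .
  qed
  have ch: "sh.chord f \<longleftrightarrow> chord f" for f by (simp add: chord_def sh.chord_def rng)
  show ?thesis
  proof (rule sh.ranks_if_shortest_chord[OF outer _ _ _ _ _ _ that])
    show "sh.chord e0" "ends G e0 = {c' 0, c' m}" "0 < m" "m < n" using e0 by (simp_all add: ch c'_def)
    show "i + m \<le> j" if "sh.chord f" "ends G f = {c' i, c' j}" "i < j" "j < i + n" for f i j
      using least[OF Qex[of f "k + i" "k + j"]] that by (simp add: ch c'_def)
    show False if "sh.chord e" "ends G e = {c' i, c' j}" "sh.chord f" "ends G f = {c' p, c' l}"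
      "i < p" "p < j" "j < l" "l < i + n" for e f i j p l
      using nc[of e "k + i" "k + j" f "k + p" "k + l"] that by (simp add: ch c'_def)
  qed
qed

end

theorem theorem4p1:
  fixes M :: "('v, 'e) map"
  assumes "planar_map M"
    and "simple_map M"
    and "two_connected_map M"
    and "weakly_outerplanar M"
    and "outerplanar (dual_graph M)"
  shows "order_dim (VF_carrier M) (VF_order M) \<le> 3"
proof -
  obtain G D where M: "M = (G, D)" by (cases M)
  have G: "finite_multigraph G" "plane_drawing G D" "simple_graph G" "k_connected 2 G"
    using assms(1-3) unfolding M planar_map_def simple_map_def two_connected_map_def by simp_all
  obtain D' Of where D': "plane_drawing G D'" "Of \<in> drawing_faces G D'"
    "\<forall>v\<in>verts G. point D' v \<in> frontier Of"
    using assms(4) unfolding M weakly_outerplanar_def outerplanar_def by auto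
  interpret pg: plane_graph G D' using G(1) D'(1) by unfold_locales
  obtain w where w: "graph_cycle G w" "set w = verts G"
    using pg.hamiltonian_cycle[OF D'(2) _ G(4)] D'(3) by blast
  define n where "n = length w"
  define c where "c i = w ! (i mod n)" for i
  have dw: "distinct w" using w by (simp add: graph_cycle_def)
  have n3: "3 \<le> n"
    using G(4) distinct_card[OF dw] w(2) by (simp add: k_connected_def n_def)
  have step: "(c i, c (Suc i)) \<in> adjacency G" for i
  proof (cases "Suc (i mod n) = n")
    case True
    then have "c i = last w" "c (Suc i) = hd w"
    proof -
      have "w \<noteq> []" using n3 by (auto simp: n_def)
      moreover have "i mod n = n - 1" using True by linarith
      ultimately show "c i = last w" "c (Suc i) = hd w"
        using True by (auto simp: c_def mod_Suc last_conv_nth hd_conv_nth n_def[symmetric])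
    qed
    then show ?thesis using w(1) by (simp add: graph_cycle_def)
  next
    case False
    moreover have "i mod n < n" using n3 by (intro mod_less_divisor) simp
    ultimately have "Suc (i mod n) < length w" unfolding n_def[symmetric] by linarith
    moreover have "walk G w" using w(1) by (simp add: graph_cycle_def)
    ultimately have "(w ! (i mod n), w ! Suc (i mod n)) \<in> adjacency G"
      by (simp add: successively_conv_nth)
    then show ?thesis using False by (simp add: c_def mod_Suc)
  qed
  then have "\<exists>e\<in>edges G. ends G e = {c i, c (Suc i)}" for i
    unfolding adjacency_def by auto
  then obtain ed where ed: "\<And>i. ed i \<in> edges G" "\<And>i. ends G (ed i) = {c i, c (Suc i)}"
    by metis
  have per: "c (i + n) = c i" for i by (simp add: c_def)
  have inj: "inj_on c {..<n}"
    using dw by (auto simp: inj_on_def c_def n_def nth_eq_iff_index_eq)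
  have onto: "c ` {..<n} = verts G"
    unfolding w(2)[symmetric] set_conv_nth by (auto simp: c_def n_def)
  \<comment> \<open>The same cyclic sequence is used in two drawings: \<open>out\<close> refers to
    the outerplanar drawing \<open>D'\<close>, and \<open>drw\<close> to the given drawing
    \<open>D\<close> with its faces and dual.\<close>
  interpret out: plane_ham G D' c n ed
    using G(3) n3 per inj onto ed by unfold_locales
  interpret drw: plane_ham_dual G D c n ed
    using G n3 per inj onto ed assms(5) unfolding M outerplanar_def by unfold_locales auto
  \<comment> \<open>Being a chord depends on the graph and the cycle only, and crossing is a
    condition on indices. So the absence of crossings passes from \<open>D'\<close> to
    \<open>D\<close>.\<close>
  have ch: "drw.chord e \<longleftrightarrow> out.chord e" for e by (simp add: drw.chord_def out.chord_def)
  have nc: False if "drw.chord e" "ends G e = {c i, c j}" "drw.chord f" "ends G f = {c k, c l}"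
    "i < k" "k < j" "j < l" "l < i + n" for e f i j k l
  proof (rule out.no_crossing_chords[OF D'(2) _ _ that(2) _ that(4-8)])
    show "point D' v \<in> frontier Of" if "v \<in> verts G" for v using D'(3) that by simp
  qed (use that(1,3) ch in simp_all)
  have op: "outerplanar (dual_graph (G, D))" using assms(5) M by simp
  show ?thesis
  proof (rule drw.ranks[OF op])
    show False if "drw.chord e" "ends G e = {c i, c j}" "drw.chord f" "ends G f = {c k, c l}"
      "i < k" "k < j" "j < l" "l < i + n" for e f i j k l
      using nc[OF that] .
    fix f1 f2 :: "'v \<Rightarrow> nat" and g1 g2
    assume inc: "\<And>v F. v \<in> verts G \<Longrightarrow> F \<in> drawing_faces G D \<Longrightarrow>
      point D v \<in> frontier F \<longleftrightarrow> f1 v \<le> g1 F \<and> f2 v \<le> g2 F"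
    show ?thesis
    proof (rule order_dim_le_3)
      fix v F assume "v \<in> verts (fst M)" "F \<in> faces M"
      then show "point (snd M) v \<in> frontier F \<longleftrightarrow> f1 v \<le> g1 F \<and> f2 v \<le> g2 F"
        using inc[of v F] by (simp add: M faces_def)
    qed
  qed
qed

end
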